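(* Let $A$ and $B$ be two groups with solvable conjugacy problem, let $a\in A$ and $b\in B$ be super-semicritical elements such that $a\mapsto b$ induces an isomorphism $\langle a\rangle\cong\langle b\rangle$, and let $G$ be the free product of $A$ and $B$ amalgamating the cyclic subgroup $H$ generated by $a$ and $b$ in the respective factors (with $a$ identified with $b$). Then $G$ has a solvable conjugacy problem.
   Context: Groups are given by presentations. A group has solvable conjugacy problem if there is an algorithm deciding, for two words in the generators, whether they represent conjugate elements. The free product of $A$ and $B$ amalgamating the cyclic subgroups generated by $a$ and $b$ is the group generated by the generators of $A$ and of $B$ subject to the relations of $A$, the relations of $B$, and the relation $a=b$, where $\langle a\rangle\cong\langle b\rangle$ via $a\mapsto b$. Let $h$ be an element of a group $\Gamma$. - $h$ is *non-self-conjugate* if its distinct powers are in different conjugacy classes of $\Gamma$. - $h$ is *conjugate-power-search-solvable* if for any $w\in\Gamma$ one can (algorithmically) decide whether or not $w$ is conjugate to a power of $h$ and, if it is, find which power of $h$ it is conjugate to; if there is more than one such power, then there are finitely many and one can find them all. - $h$ is *double-coset-search-solvable* if for any pair $u,v\in\Gamma$ one can decide whether or not there exist integers $r$ and $s$ such that $h^r u h^s=v$ and, if such $r$ and $s$ exist, one can find them; if there are many such values, there are finitely many, and one can find them all. - $h$ is *super-semicritical* if (a′) $h$ is non-self-conjugate; (b′) $h$ is conjugate-power-search-solvable; and (c′) $h$ is double-coset-search-solvable. *)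

theory Defs
  imports "HOL-Algebra.Generated_Groups" "HOL-Library.Nat_Bijection"
begin

section \<open>Recursive functions\<close>

text \<open>
  The total recursive functions of one natural-number argument, as the least class containing the
  initial functions and closed under pairing, composition, primitive recursion and minimization
  applied only where a zero always exists (regular minimization). Functions of several arguments
  are handled through the pairing bijection \<open>prod_encode\<close>.
\<close>

inductive recursive_fun :: "(nat \<Rightarrow> nat) \<Rightarrow> bool" where
  zero: "recursive_fun (\<lambda>n. 0)"
| suc: "recursive_fun Suc"
| left: "recursive_fun (\<lambda>n. fst (prod_decode n))"
| right: "recursive_fun (\<lambda>n. snd (prod_decode n))"
| pair: "recursive_fun f \<Longrightarrow> recursive_fun g \<Longrightarrow> recursive_fun (\<lambda>n. prod_encode (f n, g n))"
| comp: "recursive_fun f \<Longrightarrow> recursive_fun g \<Longrightarrow> recursive_fun (\<lambda>n. f (g n))"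
| prec: "recursive_fun f \<Longrightarrow> recursive_fun g \<Longrightarrow>
    recursive_fun (\<lambda>n. rec_nat (f (fst (prod_decode n)))
      (\<lambda>k r. g (prod_encode (fst (prod_decode n), prod_encode (k, r))))
      (snd (prod_decode n)))"
| minim: "recursive_fun f \<Longrightarrow> (\<And>n. \<exists>y. f (prod_encode (n, y)) = 0) \<Longrightarrow>
    recursive_fun (\<lambda>n. LEAST y. f (prod_encode (n, y)) = 0)"


section \<open>Groups given by presentations\<close>

text \<open>
  The letter \<open>(x, True)\<close> is the generator \<open>x\<close> and \<open>(x, False)\<close> is its formal inverse. Generators are
  named by natural numbers so that words can be fed to algorithms. The set of generators may be
  finite or infinite, and no effectiveness is imposed on the set of relators.
\<close>

type_synonym word = "(nat \<times> bool) list"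

record presentation =
  gens :: "nat set"
  rels :: "word set"

definition words :: "presentation \<Rightarrow> word set" where
  "words P = lists (gens P \<times> UNIV)"

definition wf_presentation :: "presentation \<Rightarrow> bool" where
  "wf_presentation P \<longleftrightarrow> rels P \<subseteq> words P"

definition inv_word :: "word \<Rightarrow> word" where
  "inv_word w = rev (map (\<lambda>(x, s). (x, \<not> s)) w)"

inductive word_eq :: "presentation \<Rightarrow> word \<Rightarrow> word \<Rightarrow> bool" for P where
  refl: "u \<in> words P \<Longrightarrow> word_eq P u u"
| sym: "word_eq P u v \<Longrightarrow> word_eq P v u"
| trans: "word_eq P u v \<Longrightarrow> word_eq P v w \<Longrightarrow> word_eq P u w"
| cancel: "u \<in> words P \<Longrightarrow> v \<in> words P \<Longrightarrow> x \<in> gens P \<Longrightarrow>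
    word_eq P (u @ [(x, s), (x, \<not> s)] @ v) (u @ v)"
| relator: "u \<in> words P \<Longrightarrow> v \<in> words P \<Longrightarrow> r \<in> rels P \<Longrightarrow> word_eq P (u @ r @ v) (u @ v)"

definition word_rel :: "presentation \<Rightarrow> (word \<times> word) set" where
  "word_rel P = {(u, v). word_eq P u v}"

definition elt :: "presentation \<Rightarrow> word \<Rightarrow> word set" where
  "elt P w = word_rel P `` {w}"

definition pgroup :: "presentation \<Rightarrow> word set monoid" where
  "pgroup P = \<lparr>carrier = words P // word_rel P,
     monoid.mult = (\<lambda>C D. \<Union>u\<in>C. \<Union>v\<in>D. elt P (u @ v)),
     one = elt P []\<rparr>"

lemma words_append_iff [simp]: "u @ v \<in> words P \<longleftrightarrow> u \<in> words P \<and> v \<in> words P"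
  by (auto simp: words_def)

lemma words_Nil [simp]: "[] \<in> words P"
  by (simp add: words_def)

lemma inv_word_words: "w \<in> words P \<Longrightarrow> inv_word w \<in> words P"
  by (auto simp: words_def inv_word_def in_lists_conv_set)

lemma word_eq_words:
  assumes "word_eq P u v" "wf_presentation P"
  shows "u \<in> words P \<and> v \<in> words P"
  using assms by (induction) (auto simp: wf_presentation_def words_def)

lemma word_eq_append_left:
  assumes "word_eq P u v" "w \<in> words P"
  shows "word_eq P (w @ u) (w @ v)"
  using assms(1)
proof induction
  case (refl u) then show ?case using assms(2) by (simp add: word_eq.refl)
next
  case (sym u v) show ?case by (rule word_eq.sym[OF sym.IH])
next
  case (trans u v x) show ?case by (rule word_eq.trans[OF trans.IH])
next
  case (cancel u v x s)
  then show ?case using word_eq.cancel[of "w @ u" P v x s] assms(2) by simp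
next
  case (relator u v r)
  then show ?case using word_eq.relator[of "w @ u" P v r] assms(2) by simp
qed

lemma word_eq_append_right:
  assumes "word_eq P u v" "w \<in> words P"
  shows "word_eq P (u @ w) (v @ w)"
  using assms(1)
proof induction
  case (refl u) then show ?case using assms(2) by (simp add: word_eq.refl)
next
  case (sym u v) show ?case by (rule word_eq.sym[OF sym.IH])
next
  case (trans u v x) show ?case by (rule word_eq.trans[OF trans.IH])
next
  case (cancel u v x s)
  then show ?case using word_eq.cancel[of u P "v @ w" x s] assms(2) by simp
next
  case (relator u v r)
  then show ?case using word_eq.relator[of u P "v @ w" r] assms(2) by simp
qed

lemma word_eq_append:
  assumes "wf_presentation P" "word_eq P u u'" "word_eq P v v'"
  shows "word_eq P (u @ v) (u' @ v')"
proof (rule word_eq.trans)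
  show "word_eq P (u @ v) (u' @ v)"
    using assms word_eq_words by (blast intro: word_eq_append_right)
  show "word_eq P (u' @ v) (u' @ v')"
    using assms word_eq_words by (blast intro: word_eq_append_left)
qed

lemma word_eq_inv_left: "w \<in> words P \<Longrightarrow> word_eq P (inv_word w @ w) []"
proof (induction w)
  case Nil then show ?case by (simp add: inv_word_def word_eq.refl)
next
  case (Cons l w)
  obtain x s where l: "l = (x, s)" by (cases l)
  have w: "w \<in> words P" and x: "x \<in> gens P" using Cons.prems l by (auto simp: words_def)
  have "word_eq P (inv_word w @ [(x, \<not> s), (x, \<not> \<not> s)] @ w) (inv_word w @ w)"
    by (rule word_eq.cancel) (use w x inv_word_words in auto)
  from word_eq.trans[OF this Cons.IH[OF w]] show ?case by (simp add: l inv_word_def)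
qed

lemma equiv_word_rel:
  assumes "wf_presentation P"
  shows "equiv (words P) (word_rel P)"
proof (rule equivI)
  show "word_rel P \<subseteq> words P \<times> words P"
    using word_eq_words[OF _ assms] by (auto simp: word_rel_def)
  show "refl_on (words P) (word_rel P)"
    by (auto simp: word_rel_def refl_on_def intro: word_eq.refl)
  show "sym (word_rel P)"
    unfolding word_rel_def sym_def using word_eq.sym by blast
  show "trans (word_rel P)"
    unfolding word_rel_def trans_def using word_eq.trans by blast
qed

lemma carrier_pgroup: "carrier (pgroup P) = elt P ` words P"
  by (auto simp: pgroup_def quotient_def elt_def)

lemma elt_closed: "w \<in> words P \<Longrightarrow> elt P w \<in> carrier (pgroup P)"
  by (simp add: carrier_pgroup)

lemma one_pgroup: "\<one>\<^bsub>pgroup P\<^esub> = elt P []"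
  by (simp add: pgroup_def)

lemma elt_eq_iff:
  assumes "wf_presentation P" "u \<in> words P" "v \<in> words P"
  shows "elt P u = elt P v \<longleftrightarrow> word_eq P u v"
  using eq_equiv_class_iff[OF equiv_word_rel[OF assms(1)] assms(2,3)]
  by (simp add: elt_def word_rel_def)

lemma mult_elt:
  assumes "wf_presentation P" "u \<in> words P" "v \<in> words P"
  shows "elt P u \<otimes>\<^bsub>pgroup P\<^esub> elt P v = elt P (u @ v)"
proof -
  have "elt P (u' @ v') = elt P (u @ v)" if "u' \<in> elt P u" "v' \<in> elt P v" for u' v'
  proof -
    have "word_eq P u u'" "word_eq P v v'" using that by (auto simp: elt_def word_rel_def)
    then have "word_eq P (u @ v) (u' @ v')" "u' @ v' \<in> words P"
      using word_eq_append[OF assms(1)] word_eq_words[OF _ assms(1)] by auto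
    then show ?thesis
      using elt_eq_iff[OF assms(1), of "u @ v" "u' @ v'"] assms by simp
  qed
  moreover have "u \<in> elt P u" "v \<in> elt P v"
    using assms by (auto simp: elt_def word_rel_def word_eq.refl)
  ultimately have "(\<Union>u'\<in>elt P u. \<Union>v'\<in>elt P v. elt P (u' @ v')) = elt P (u @ v)"
    by blast
  then show ?thesis by (simp add: pgroup_def)
qed

lemma group_pgroup:
  assumes wf: "wf_presentation P"
  shows "group (pgroup P)"
proof (rule groupI)
  fix x y assume "x \<in> carrier (pgroup P)" "y \<in> carrier (pgroup P)"
  then show "x \<otimes>\<^bsub>pgroup P\<^esub> y \<in> carrier (pgroup P)"
    by (auto simp: carrier_pgroup mult_elt[OF wf])
next
  show "\<one>\<^bsub>pgroup P\<^esub> \<in> carrier (pgroup P)" by (simp add: one_pgroup elt_closed)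
next
  fix x y z
  assume "x \<in> carrier (pgroup P)" "y \<in> carrier (pgroup P)" "z \<in> carrier (pgroup P)"
  then show "x \<otimes>\<^bsub>pgroup P\<^esub> y \<otimes>\<^bsub>pgroup P\<^esub> z = x \<otimes>\<^bsub>pgroup P\<^esub> (y \<otimes>\<^bsub>pgroup P\<^esub> z)"
    by (auto simp: carrier_pgroup mult_elt[OF wf])
next
  fix x assume "x \<in> carrier (pgroup P)"
  then show "\<one>\<^bsub>pgroup P\<^esub> \<otimes>\<^bsub>pgroup P\<^esub> x = x"
    by (auto simp: carrier_pgroup one_pgroup mult_elt[OF wf])
next
  fix x assume "x \<in> carrier (pgroup P)"
  then obtain w where w: "w \<in> words P" "x = elt P w" by (auto simp: carrier_pgroup)
  have "elt P (inv_word w) \<otimes>\<^bsub>pgroup P\<^esub> x = \<one>\<^bsub>pgroup P\<^esub>"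
    using w by (simp add: mult_elt[OF wf] inv_word_words one_pgroup elt_eq_iff[OF wf]
        word_eq_inv_left)
  then show "\<exists>y\<in>carrier (pgroup P). y \<otimes>\<^bsub>pgroup P\<^esub> x = \<one>\<^bsub>pgroup P\<^esub>"
    using w inv_word_words elt_closed by blast
qed


section \<open>Algorithmic properties\<close>

definition word_code :: "word \<Rightarrow> nat" where
  "word_code w = list_encode (map (\<lambda>(x, s). prod_encode (x, of_bool s)) w)"

definition int_list_decode :: "nat \<Rightarrow> int list" where
  "int_list_decode n = map int_decode (list_decode n)"

definition int_pair_list_decode :: "nat \<Rightarrow> (int \<times> int) list" where
  "int_pair_list_decode n = map (map_prod int_decode int_decode \<circ> prod_decode) (list_decode n)"

definition conjugate :: "('a, 'b) monoid_scheme \<Rightarrow> 'a \<Rightarrow> 'a \<Rightarrow> bool" where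
  "conjugate G x y \<longleftrightarrow> (\<exists>g\<in>carrier G. y = inv\<^bsub>G\<^esub> g \<otimes>\<^bsub>G\<^esub> x \<otimes>\<^bsub>G\<^esub> g)"

text \<open>
  The algorithms below are only required to give correct answers on words over the generators;
  on codes of anything else they may return an arbitrary number.
\<close>

definition solvable_conjugacy_problem :: "presentation \<Rightarrow> bool" where
  "solvable_conjugacy_problem P \<longleftrightarrow>
    (\<exists>f. recursive_fun f \<and>
      (\<forall>u\<in>words P. \<forall>v\<in>words P.
        f (prod_encode (word_code u, word_code v)) =
          (if conjugate (pgroup P) (elt P u) (elt P v) then 1 else 0)))"

definition non_self_conjugate :: "('a, 'b) monoid_scheme \<Rightarrow> 'a \<Rightarrow> bool" where
  "non_self_conjugate G h \<longleftrightarrow>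
    (\<forall>(m::int) (n::int). h [^]\<^bsub>G\<^esub> m \<noteq> h [^]\<^bsub>G\<^esub> n \<longrightarrow> \<not> conjugate G (h [^]\<^bsub>G\<^esub> m) (h [^]\<^bsub>G\<^esub> n))"

text \<open>
  An algorithm that searches outputs a list of exponents, which is empty exactly when there is no
  solution. Powers are counted as group elements: if \<open>h\<close> has finite order, the list has to
  represent each solution modulo the order. If \<open>h\<close> has infinite order, the list has to contain
  literally all exponents.
\<close>

definition conjugate_power_search_solvable :: "presentation \<Rightarrow> word set \<Rightarrow> bool" where
  "conjugate_power_search_solvable P h \<longleftrightarrow>
    (\<exists>f. recursive_fun f \<and>
      (\<forall>w\<in>words P.
        let L = set (int_list_decode (f (word_code w))) in
        (\<forall>k\<in>L. conjugate (pgroup P) (elt P w) (h [^]\<^bsub>pgroup P\<^esub> k)) \<and>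
        (\<forall>k::int. conjugate (pgroup P) (elt P w) (h [^]\<^bsub>pgroup P\<^esub> k) \<longrightarrow>
          (\<exists>k'\<in>L. h [^]\<^bsub>pgroup P\<^esub> k' = h [^]\<^bsub>pgroup P\<^esub> k))))"

definition double_coset_solution ::
  "('a, 'b) monoid_scheme \<Rightarrow> 'a \<Rightarrow> 'a \<Rightarrow> 'a \<Rightarrow> int \<times> int \<Rightarrow> bool" where
  "double_coset_solution G h u v = (\<lambda>(r, s). h [^]\<^bsub>G\<^esub> r \<otimes>\<^bsub>G\<^esub> u \<otimes>\<^bsub>G\<^esub> h [^]\<^bsub>G\<^esub> s = v)"

text \<open>
  If \<open>u\<close> is a power of \<open>h\<close> and \<open>h\<close> has infinite order, then \<open>h\<^sup>r u h\<^sup>s = v\<close> has either no solution or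
  infinitely many, since \<open>(r, s)\<close> can be replaced by \<open>(r + t, s - t)\<close>. Hence finiteness, and the
  computation of all solutions, can only be demanded for \<open>u\<close> outside the subgroup generated by
  \<open>h\<close>. For \<open>u\<close> inside it one decides solvability and finds a solution.
\<close>

definition double_coset_search_solvable :: "presentation \<Rightarrow> word set \<Rightarrow> bool" where
  "double_coset_search_solvable P h \<longleftrightarrow>
    (\<exists>f. recursive_fun f \<and>
      (\<forall>u\<in>words P. \<forall>v\<in>words P.
        let L = set (int_pair_list_decode (f (prod_encode (word_code u, word_code v))));
            sol = double_coset_solution (pgroup P) h (elt P u) (elt P v) in
        (\<forall>p\<in>L. sol p) \<and>
        ((\<exists>p. sol p) \<longrightarrow> L \<noteq> {}) \<and>
        (elt P u \<notin> generate (pgroup P) {h} \<longrightarrow>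
          (\<forall>r s. sol (r, s) \<longrightarrow>
            (\<exists>(r', s')\<in>L. h [^]\<^bsub>pgroup P\<^esub> r' = h [^]\<^bsub>pgroup P\<^esub> r \<and>
              h [^]\<^bsub>pgroup P\<^esub> s' = h [^]\<^bsub>pgroup P\<^esub> s)))))"

definition super_semicritical :: "presentation \<Rightarrow> word set \<Rightarrow> bool" where
  "super_semicritical P h \<longleftrightarrow>
    non_self_conjugate (pgroup P) h \<and>
    conjugate_power_search_solvable P h \<and>
    double_coset_search_solvable P h"


section \<open>Free products amalgamating cyclic subgroups\<close>

text \<open>The generators of the two factors are made disjoint by using even and odd numbers.\<close>

definition word_inl :: "word \<Rightarrow> word" where
  "word_inl w = map (\<lambda>(x, s). (2 * x, s)) w"

definition word_inr :: "word \<Rightarrow> word" where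
  "word_inr w = map (\<lambda>(x, s). (2 * x + 1, s)) w"

definition amalgam :: "presentation \<Rightarrow> presentation \<Rightarrow> word \<Rightarrow> word \<Rightarrow> presentation" where
  "amalgam A B a b =
    \<lparr>gens = (\<lambda>x. 2 * x) ` gens A \<union> (\<lambda>x. 2 * x + 1) ` gens B,
     rels = word_inl ` rels A \<union> word_inr ` rels B \<union> {word_inl a @ inv_word (word_inr b)}\<rparr>"

lemma wf_amalgam:
  assumes "wf_presentation A" "wf_presentation B" "a \<in> words A" "b \<in> words B"
  shows "wf_presentation (amalgam A B a b)"
proof -
  have "word_inl w \<in> words (amalgam A B a b)" if "w \<in> words A" for w
    using that by (auto simp: word_inl_def words_def amalgam_def in_lists_conv_set)
  moreover have "word_inr w \<in> words (amalgam A B a b)" if "w \<in> words B" for w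
    using that by (auto simp: word_inr_def words_def amalgam_def in_lists_conv_set)
  moreover have "rels (amalgam A B a b) =
      word_inl ` rels A \<union> word_inr ` rels B \<union> {word_inl a @ inv_word (word_inr b)}"
    by (simp add: amalgam_def)
  ultimately show ?thesis
    using assms by (auto simp: wf_presentation_def inv_word_words)
qed

definition cyclic_subgroup :: "presentation \<Rightarrow> word set \<Rightarrow> word set monoid" where
  "cyclic_subgroup P h = (pgroup P)\<lparr>carrier := generate (pgroup P) {h}\<rparr>"

end

(*
  Normal forms (van der Waerden's action on sequences of coset representatives) embed the factors
  in the amalgamated product and show that the sequence of factors visited by a reduced product is
  an invariant. Peeling syllables off a conjugating element then gives Solitar's conjugacy theorem:
  cyclically reduced products of length at least 2 are conjugate iff they agree up to rotation
  and conjugation by a power of h; elements of the factors are conjugate iff they are conjugate in one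
  factor or both conjugate to the same power of h, because distinct powers of h are never conjugate.
  For the algorithm: membership in the subgroup generated by h is a double coset problem with u = 1,
  so words can be cyclically reduced. In the long case, comparing first syllables of S and a
  rotation R of T leaves, by double coset search, finitely many candidates h^r with
  h^r S h^(-r) = R, and each is tested by the word problem, which cyclic reduction solves. In the
  short case conjugate-power search lists the powers of h to be tested.
*)

theory Submission
  imports Defs
begin

section \<open>Computable functions on encoded types\<close>

text \<open>Group elements become permutations (left translations), so all group algebra takes place
  in a type of class \<open>group_add\<close> without carrier conditions; only conjugators still
  have to be confined to the image of the group. The order of \<open>a\<close> and \<open>b\<close>
  may be finite, and then one element carries many exponents: normal forms use canonical exponents,
  and oracle answers are compared as group elements, never as integers. Double coset search lists
  all solutions only when the middle element lies outside the subgroup. First syllables of reduced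
  products are such elements, while for u = 1 a single solution already decides membership and
  yields an exponent. The left exponent r alone determines the conjugator h^r, and the word test on
  h^r S h^(-r) R^(-1) makes every accepted candidate correct. Cyclic reduction changes its input by
  a conjugation, yet it decides the word problem because only 1 is conjugate to 1. Solitar's theorem
  in general allows a chain of conjugate powers of unbounded length between two short elements;
  non-self-conjugacy collapses it to one power, which the search can list.\<close>

class encodable =
  fixes enc :: "'a \<Rightarrow> nat"

instantiation nat :: encodable
begin
definition enc_nat :: "nat \<Rightarrow> nat" where "enc_nat n = n"
instance ..
end

instantiation bool :: encodable
begin
definition enc_bool :: "bool \<Rightarrow> nat" where "enc_bool b = of_bool b"
instance ..
end

instantiation int :: encodable
begin
definition enc_int :: "int \<Rightarrow> nat" where "enc_int = int_encode"
instance ..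
end

instantiation prod :: (encodable, encodable) encodable
begin
definition enc_prod :: "'a \<times> 'b \<Rightarrow> nat" where "enc_prod p = prod_encode (enc (fst p), enc (snd p))"
instance ..
end

instantiation list :: (encodable) encodable
begin
definition enc_list :: "'a list \<Rightarrow> nat" where "enc_list xs = list_encode (map enc xs)"
instance ..
end

lemma enc_word: "enc (w :: word) = word_code w"
  unfolding enc_list_def word_code_def
  by (rule arg_cong[where f = list_encode], rule map_cong)
    (auto simp: enc_prod_def enc_nat_def enc_bool_def)

text \<open>Every number codes the list it decodes to, so the raw output of a search algorithm is
  already the code of its list of exponents.\<close>

lemma enc_int_list_decode: "enc (int_list_decode n) = n"
  by (simp add: enc_list_def int_list_decode_def enc_int_def o_def)

lemma enc_int_pair_list_decode: "enc (int_pair_list_decode n) = n"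
proof -
  have "map (enc \<circ> (map_prod int_decode int_decode \<circ> prod_decode)) xs = xs" for xs
    by (rule map_idI) (simp add: enc_prod_def enc_int_def map_prod_def split: prod.splits, metis prod.collapse prod_decode_inverse)
  then show ?thesis
    by (simp add: enc_list_def int_pair_list_decode_def)
qed

subsection \<open>Recursive functions\<close>

lemma recursive_fun_id: "recursive_fun (\<lambda>n. n)"
  using recursive_fun.pair[OF recursive_fun.left recursive_fun.right] by simp

lemma recursive_fun_const: "recursive_fun (\<lambda>n. c)"
proof (induction c)
  case (Suc c)
  then show ?case using recursive_fun.comp[OF recursive_fun.suc] by blast
qed (rule recursive_fun.zero)

text \<open>Composing \<open>prec\<close> with the map from \<open>n\<close> to the pair of
  \<open>n\<close> and \<open>h n\<close> makes the input both the parameter and the source of the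
  recursion depth.\<close>

lemma recursive_fun_rec_nat:
  assumes f: "recursive_fun f" and g: "recursive_fun g" and h: "recursive_fun h"
  shows "recursive_fun (\<lambda>n. rec_nat (f n) (\<lambda>k r. g (prod_encode (n, prod_encode (k, r)))) (h n))"
  using recursive_fun.comp[OF recursive_fun.prec[OF f g] recursive_fun.pair[OF recursive_fun_id h]]
  by simp

text \<open>Branching is a primitive recursion of depth \<open>c n\<close> whose step ignores the
  previous value.\<close>

lemma recursive_fun_if_zero:
  assumes c: "recursive_fun c" and f: "recursive_fun f" and g: "recursive_fun g"
  shows "recursive_fun (\<lambda>n. if c n = 0 then f n else g n)"
proof -
  have "rec_nat (f n) (\<lambda>k r. g n) (c n) = (if c n = 0 then f n else g n)" for n
    by (cases "c n") auto
  then show ?thesis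
    using recursive_fun_rec_nat[OF f recursive_fun.comp[OF g recursive_fun.left] c] by simp
qed

lemma recursive_fun_pred: "recursive_fun (\<lambda>n. n - 1)"
proof -
  have "rec_nat 0 (\<lambda>k r. k) n = n - 1" for n
    by (cases n) auto
  then show ?thesis
    using recursive_fun_rec_nat[OF recursive_fun.zero
        recursive_fun.comp[OF recursive_fun.left recursive_fun.right] recursive_fun_id]
    by simp
qed

lemma recursive_fun_fst: "recursive_fun f \<Longrightarrow> recursive_fun (\<lambda>n. fst (prod_decode (f n)))"
  by (rule recursive_fun.comp[OF recursive_fun.left])

lemma recursive_fun_snd: "recursive_fun f \<Longrightarrow> recursive_fun (\<lambda>n. snd (prod_decode (f n)))"
  by (rule recursive_fun.comp[OF recursive_fun.right])

lemma recursive_fun_foldl: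
  assumes f: "recursive_fun f" and g: "recursive_fun g" and h: "recursive_fun h"
  shows "recursive_fun (\<lambda>n. foldl (\<lambda>s y. g (prod_encode (n, prod_encode (s, y)))) (f n) (list_decode (h n)))"
proof -
  let ?G = "\<lambda>n s y. g (prod_encode (n, prod_encode (s, y)))"
  \<comment> \<open>The state pairs the code of the remaining list with the accumulator; the code of a list
      bounds its length, so that many steps exhaust it.\<close>
  define st where "st n p = (if fst (prod_decode p) = 0 then p else
      prod_encode (snd (prod_decode (fst (prod_decode p) - 1)),
        ?G n (snd (prod_decode p)) (fst (prod_decode (fst (prod_decode p) - 1)))))" for n p
  \<comment> \<open>A nonempty list has code \<open>Suc (prod_encode (head, code of tail))\<close>,
    whence the predecessor in \<open>st\<close>.\<close>
  have st_enc: "st n (prod_encode (list_encode xs, s)) =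
      (case xs of [] \<Rightarrow> prod_encode (0, s) | y # ys \<Rightarrow> prod_encode (list_encode ys, ?G n s y))" for n xs s
    by (auto simp: st_def split: list.splits)
  \<comment> \<open>An inequality suffices because the state of the empty list is a fixed point of
    \<open>st\<close>.\<close>
  have run: "length xs \<le> k \<Longrightarrow>
      ((st n) ^^ k) (prod_encode (list_encode xs, s)) = prod_encode (0, foldl (?G n) s xs)" for n xs k s
  proof (induction k arbitrary: xs s)
    case (Suc k)
    then show ?case
    proof (cases xs)
      case Nil
      then show ?thesis using Suc.IH[of "[]" s] by (simp add: funpow_swap1 st_def)
    next
      case (Cons y ys)
      then show ?thesis using Suc.IH[of ys "?G n s y"] Suc.prems
        by (simp only: funpow_Suc_right o_apply st_enc) simp
    qed
  qed simp
  have len: "length xs \<le> list_encode xs" for xs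
  proof (induction xs)
    case (Cons x xs)
    then show ?case using le_prod_encode_2[of "list_encode xs" x] by simp
  qed simp
  define step where "step m = st (fst (prod_decode m)) (snd (prod_decode (snd (prod_decode m))))" for m
  have "recursive_fun step"
    unfolding step_def st_def
    by (intro recursive_fun_if_zero recursive_fun.pair recursive_fun.comp[OF g]
        recursive_fun.comp[OF recursive_fun_pred] recursive_fun_fst recursive_fun_snd recursive_fun_id)
  from recursive_fun_rec_nat[OF recursive_fun.pair[OF h f] this h]
  have "recursive_fun (\<lambda>n. snd (prod_decode (rec_nat (prod_encode (h n, f n)) (\<lambda>k. st n) (h n))))"
    by (intro recursive_fun_snd) (simp add: step_def)
  moreover have "snd (prod_decode (rec_nat (prod_encode (h n, f n)) (\<lambda>k. st n) (h n))) =
      foldl (?G n) (f n) (list_decode (h n))" for n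
  proof -
    have "rec_nat z (\<lambda>k. st n) k = (st n ^^ k) z" for z k
      by (induction k) auto
    then show ?thesis
      using run[of "list_decode (h n)" "h n" n "f n"] len[of "list_decode (h n)"] by simp
  qed
  ultimately show ?thesis by simp
qed

subsection \<open>Closure properties\<close>

text \<open>Tracking on codes: the recursive function may do anything on numbers outside the range
  of \<open>enc\<close>.\<close>

definition computable :: "('a::encodable \<Rightarrow> 'b::encodable) \<Rightarrow> bool" where
  "computable f \<longleftrightarrow> (\<exists>g. recursive_fun g \<and> (\<forall>x. g (enc x) = enc (f x)))"

lemma computableI: "recursive_fun g \<Longrightarrow> (\<And>x. g (enc x) = enc (f x)) \<Longrightarrow> computable f"
  unfolding computable_def by blast

lemma computableE:
  assumes "computable f"
  obtains g where "recursive_fun g" "\<And>x. g (enc x) = enc (f x)"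
  using assms unfolding computable_def by blast

named_theorems computable_intros

lemma computable_id [computable_intros]: "computable (\<lambda>x. x)"
  by (rule computableI[OF recursive_fun_id]) simp

lemma computable_const [computable_intros]: "computable (\<lambda>x. c)"
  by (rule computableI[OF recursive_fun_const]) simp

lemma computable_comp:
  assumes "computable f" "computable g"
  shows "computable (\<lambda>x. f (g x))"
proof -
  obtain f' g' where "recursive_fun f'" "\<And>x. f' (enc x) = enc (f x)"
    "recursive_fun g'" "\<And>x. g' (enc x) = enc (g x)"
    using assms by (metis computableE)
  then show ?thesis
    by (intro computableI[OF recursive_fun.comp[of f' g']]) auto
qed

lemma computable_Pair [computable_intros]:
  assumes "computable f" "computable g"
  shows "computable (\<lambda>x. (f x, g x))"
proof -
  obtain f' g' where "recursive_fun f'" "\<And>x. f' (enc x) = enc (f x)"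
    "recursive_fun g'" "\<And>x. g' (enc x) = enc (g x)"
    using assms by (metis computableE)
  then show ?thesis
    by (intro computableI[OF recursive_fun.pair[of f' g']]) (auto simp: enc_prod_def)
qed

lemma computable_fst [computable_intros]:
  "computable (f :: 'a::encodable \<Rightarrow> 'b::encodable \<times> 'c::encodable) \<Longrightarrow> computable (\<lambda>x. fst (f x))"
  by (rule computable_comp[of fst], rule computableI[OF recursive_fun.left])
    (auto simp: enc_prod_def)

lemma computable_snd [computable_intros]:
  "computable (f :: 'a::encodable \<Rightarrow> 'b::encodable \<times> 'c::encodable) \<Longrightarrow> computable (\<lambda>x. snd (f x))"
  by (rule computable_comp[of snd], rule computableI[OF recursive_fun.right])
    (auto simp: enc_prod_def)

lemma computable_Suc [computable_intros]: "computable f \<Longrightarrow> computable (\<lambda>x. Suc (f x))"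
  by (rule computable_comp[of Suc], rule computableI[OF recursive_fun.suc])
    (auto simp: enc_nat_def)

lemma computable_nat_nonzero [computable_intros]: "computable f \<Longrightarrow> computable (\<lambda>x. f x \<noteq> (0::nat))"
  by (rule computable_comp[of "\<lambda>n. n \<noteq> 0"],
      rule computableI[OF recursive_fun_if_zero[OF recursive_fun_id recursive_fun_const recursive_fun_const, of 0 1]])
    (auto simp: enc_nat_def enc_bool_def)

lemma computable_if [computable_intros]:
  assumes "computable P" "computable f" "computable g"
  shows "computable (\<lambda>x. if P x then f x else g x)"
proof -
  obtain P' f' g' where "recursive_fun P'" "\<And>x. P' (enc x) = enc (P x)"
    "recursive_fun f'" "\<And>x. f' (enc x) = enc (f x)" "recursive_fun g'" "\<And>x. g' (enc x) = enc (g x)"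
    using assms by (metis computableE)
  then show ?thesis
    by (intro computableI[OF recursive_fun_if_zero[of P' g' f']]) (auto simp: enc_bool_def)
qed

lemma computable_not [computable_intros]:
  assumes "computable P"
  shows "computable (\<lambda>x. \<not> P x)"
proof -
  have "(\<lambda>x. \<not> P x) = (\<lambda>x. if P x then False else True)" by auto
  then show ?thesis using assms by (simp only: computable_if computable_const)
qed

lemma computable_conj [computable_intros]:
  "computable P \<Longrightarrow> computable Q \<Longrightarrow> computable (\<lambda>x. P x \<and> Q x)"
  using computable_if[of P Q "\<lambda>x. False"] by (simp add: computable_const if_bool_eq_conj conj_commute cong: conj_cong)

lemma computable_disj [computable_intros]:
  "computable P \<Longrightarrow> computable Q \<Longrightarrow> computable (\<lambda>x. P x \<or> Q x)"
  using computable_not[OF computable_conj[OF computable_not computable_not]] by fastforce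

lemma computable_bool_eq [computable_intros]:
  fixes P Q :: "_ \<Rightarrow> bool"
  assumes "computable P" "computable Q"
  shows "computable (\<lambda>x. P x = Q x)"
proof -
  have "(\<lambda>x. P x = Q x) = (\<lambda>x. if P x then Q x else \<not> Q x)" by auto
  then show ?thesis using assms by (simp only: computable_if computable_not)
qed

text \<open>Since \<open>computable\<close> speaks of unary functions, the premise on the step
  function bundles parameter, counter and previous value in one nested pair. The rules for folds and
  list cases have the same shape, which lets \<open>computable_intros\<close> work down a program
  syntactically.\<close>

lemma computable_rec_nat [computable_intros]:
  assumes "computable f" "computable (\<lambda>p. g (fst p) (fst (snd p)) (snd (snd p)))" "computable n"
  shows "computable (\<lambda>x. rec_nat (f x) (\<lambda>k r. g x k r) (n x))"
proof -
  obtain f' where f': "recursive_fun f'" "\<And>x. f' (enc x) = enc (f x)"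
    using assms(1) by (metis computableE)
  obtain n' where n': "recursive_fun n'" "\<And>x. n' (enc x) = enc (n x)"
    using assms(3) by (metis computableE)
  obtain g' where g': "recursive_fun g'"
    "\<And>p. g' (enc p) = enc (g (fst p) (fst (snd p)) (snd (snd p)))"
    by (rule computableE[OF assms(2)]) blast
  have g'_eq: "g' (prod_encode (enc x, prod_encode (k, enc r))) = enc (g x k r)" for x k r
    using g'(2)[of "(x, k, r)"] by (simp add: enc_prod_def enc_nat_def)
  have "rec_nat (f' (enc x)) (\<lambda>k r. g' (prod_encode (enc x, prod_encode (k, r)))) m =
    enc (rec_nat (f x) (\<lambda>k r. g x k r) m)" for x m
    by (induction m) (simp_all add: f'(2) g'_eq)
  then show ?thesis
    by (intro computableI[OF recursive_fun_rec_nat[OF f'(1) g'(1) n'(1)]]) (simp add: n' enc_nat_def)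
qed

lemma computable_Cons [computable_intros]:
  assumes "computable f" "computable l"
  shows "computable (\<lambda>x. f x # l x)"
proof -
  obtain f' l' where "recursive_fun f'" "\<And>x. f' (enc x) = enc (f x)"
    "recursive_fun l'" "\<And>x. l' (enc x) = enc (l x)"
    using assms by (metis computableE)
  then show ?thesis
    by (intro computableI[OF recursive_fun.comp[OF recursive_fun.suc recursive_fun.pair[of f' l']]])
      (auto simp: enc_list_def)
qed

lemma computable_case_list [computable_intros]:
  assumes "computable f" "computable (\<lambda>p. g (fst p) (fst (snd p)) (snd (snd p)))" "computable l"
  shows "computable (\<lambda>x. case l x of [] \<Rightarrow> f x | y # ys \<Rightarrow> g x y ys)"
proof -
  obtain f' where f': "recursive_fun f'" "\<And>x. f' (enc x) = enc (f x)"
    using assms(1) by (metis computableE)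
  obtain l' where l': "recursive_fun l'" "\<And>x. l' (enc x) = enc (l x)"
    using assms(3) by (metis computableE)
  obtain g' where g': "recursive_fun g'"
    "\<And>p. g' (enc p) = enc (g (fst p) (fst (snd p)) (snd (snd p)))"
    by (rule computableE[OF assms(2)]) blast
  have g'_eq: "g' (prod_encode (enc x, prod_encode (enc y, list_encode (map enc ys)))) = enc (g x y ys)" for x y ys
    using g'(2)[of "(x, y, ys)"] by (simp add: enc_prod_def enc_list_def)
  \<comment> \<open>The code of \<open>[]\<close> is 0, and the predecessor of a nonempty code is
    the pair of head and tail, exactly the second component that \<open>g'\<close> expects.\<close>
  have rec: "recursive_fun (\<lambda>n. if l' n = 0 then f' n else g' (prod_encode (n, l' n - 1)))"
    by (intro recursive_fun_if_zero f' l' recursive_fun.comp[OF g'(1)] recursive_fun.pair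
        recursive_fun_id recursive_fun.comp[OF recursive_fun_pred])
  show ?thesis
    by (rule computableI[OF rec]) (auto simp: l' f' g'_eq enc_list_def split: list.splits)
qed

lemma computable_foldl [computable_intros]:
  assumes "computable f" "computable (\<lambda>p. g (fst p) (fst (snd p)) (snd (snd p)))" "computable l"
  shows "computable (\<lambda>x. foldl (\<lambda>s y. g x s y) (f x) (l x))"
proof -
  obtain f' where f': "recursive_fun f'" "\<And>x. f' (enc x) = enc (f x)"
    using assms(1) by (metis computableE)
  obtain l' where l': "recursive_fun l'" "\<And>x. l' (enc x) = enc (l x)"
    using assms(3) by (metis computableE)
  obtain g' where g': "recursive_fun g'"
    "\<And>p. g' (enc p) = enc (g (fst p) (fst (snd p)) (snd (snd p)))"
    by (rule computableE[OF assms(2)]) blast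
  have g'_eq: "g' (prod_encode (enc x, prod_encode (enc s, enc y))) = enc (g x s y)" for x s y
    using g'(2)[of "(x, s, y)"] by (simp add: enc_prod_def)
  have "foldl (\<lambda>s y. g' (prod_encode (enc x, prod_encode (s, y)))) (enc s) (map enc ys) =
      enc (foldl (\<lambda>s y. g x s y) s ys)" for x s ys
    by (induction ys arbitrary: s) (simp_all add: g'_eq)
  then show ?thesis
    by (intro computableI[OF recursive_fun_foldl[OF f'(1) g'(1) l'(1)]]) (simp add: l' f' enc_list_def)
qed

lemma computable_rev [computable_intros]:
  assumes "computable l"
  shows "computable (\<lambda>x. rev (l x))"
proof -
  have eq: "foldl (\<lambda>s y. y # s) zs ys = rev ys @ zs" for ys zs
    by (induction ys arbitrary: zs) auto
  have "computable (\<lambda>x. foldl (\<lambda>s y. y # s) [] (l x))"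
    by (intro computable_intros assms)
  then show ?thesis by (simp add: eq)
qed

lemma computable_append [computable_intros]:
  assumes "computable l" "computable m"
  shows "computable (\<lambda>x. l x @ m x)"
proof -
  have eq: "foldl (\<lambda>s y. y # s) zs ys = rev ys @ zs" for ys zs
    by (induction ys arbitrary: zs) auto
  have "computable (\<lambda>x. foldl (\<lambda>s y. y # s) (m x) (rev (l x)))"
    by (intro computable_intros assms)
  then show ?thesis by (simp add: eq)
qed

lemma computable_map [computable_intros]:
  assumes "computable (\<lambda>p. f (fst p) (snd p))" "computable l"
  shows "computable (\<lambda>x. map (\<lambda>y. f x y) (l x))"
proof -
  have eq: "foldl (\<lambda>s y. s @ [f x y]) zs ys = zs @ map (f x) ys" for x ys zs
    by (induction ys arbitrary: zs) auto
  \<comment> \<open>The fold supplies parameter, accumulator and element; \<open>f\<close> is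
    precomposed with the projection that forgets the accumulator.\<close>
  have "computable (\<lambda>p::'a \<times> 'c list \<times> 'b. f (fst p) (snd (snd p)))"
    using computable_comp[OF assms(1), of "\<lambda>p::'a \<times> 'c list \<times> 'b. (fst p, snd (snd p))"]
    by (simp add: computable_intros)
  then have "computable (\<lambda>x. foldl (\<lambda>s y. s @ [f x y]) [] (l x))"
    by (intro computable_intros assms)
  then show ?thesis by (simp add: eq)
qed

lemma computable_concat [computable_intros]:
  assumes "computable l"
  shows "computable (\<lambda>x. concat (l x))"
proof -
  have "computable (\<lambda>x. foldl (\<lambda>s y. s @ y) [] (l x))"
    by (intro computable_intros assms)
  moreover have "foldl (\<lambda>s y. s @ y) zs ys = zs @ concat ys" for zs :: "'b list" and ys
    by (induction ys arbitrary: zs) auto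
  ultimately show ?thesis by simp
qed

lemma computable_list_ex [computable_intros]:
  assumes "computable (\<lambda>p. P (fst p) (snd p))" "computable l"
  shows "computable (\<lambda>x. list_ex (\<lambda>y. P x y) (l x))"
proof -
  have eq: "foldl (\<lambda>s y. s \<or> P x y) b ys \<longleftrightarrow> b \<or> list_ex (P x) ys" for x ys b
    by (induction ys arbitrary: b) auto
  have "computable (\<lambda>p::'a \<times> bool \<times> 'b. P (fst p) (snd (snd p)))"
    using computable_comp[OF assms(1), of "\<lambda>p::'a \<times> bool \<times> 'b. (fst p, snd (snd p))"]
    by (simp add: computable_intros)
  then have "computable (\<lambda>x. foldl (\<lambda>s y. s \<or> P x y) False (l x))"
    by (intro computable_intros assms)
  then show ?thesis by (simp add: eq)
qed

text \<open>Both values come from one recursion, since the half grows exactly when the parity turns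
  from odd to even. They are needed to tell the two factors' generators apart and to read signed
  exponents.\<close>

lemma computable_parity_half:
  assumes "computable n"
  shows "computable (\<lambda>x. even (n x :: nat))" "computable (\<lambda>x. n x div 2)"
proof -
  have eq: "rec_nat (True, 0) (\<lambda>k r. (\<not> fst r, if fst r then snd r else Suc (snd r))) m = (even m, m div 2)" for m
    by (induction m) (auto simp: div2_Suc_Suc elim: evenE oddE)
  have "computable (\<lambda>x. rec_nat (True, 0) (\<lambda>k r. (\<not> fst r, if fst r then snd r else Suc (snd r))) (n x))"
    by (intro computable_intros assms)
  then have "computable (\<lambda>x. (even (n x), n x div 2))" by (simp only: eq)
  from computable_fst[OF this] computable_snd[OF this]
  show "computable (\<lambda>x. even (n x))" "computable (\<lambda>x. n x div 2)" by simp_all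
qed

lemma computable_double [computable_intros]:
  assumes "computable n"
  shows "computable (\<lambda>x. 2 * n x :: nat)"
proof -
  have eq: "rec_nat 0 (\<lambda>k r. Suc (Suc r)) m = 2 * m" for m
    by (induction m) auto
  have "computable (\<lambda>x. rec_nat 0 (\<lambda>k r. Suc (Suc r)) (n x))"
    by (intro computable_intros assms)
  then show ?thesis by (simp only: eq)
qed

section \<open>Words acting by permutations\<close>

text \<open>
  Groups given by presentations are embedded in groups of permutations, so that equality in the
  group becomes equality in a type of class \<open>group_add\<close> and no carrier conditions remain.
\<close>

typedef 'a permutation = "{f :: 'a \<Rightarrow> 'a. bij f}"
  by (rule exI[of _ id]) simp

setup_lifting type_definition_permutation

instantiation permutation :: (type) group_add
begin
lift_definition zero_permutation :: "'a permutation" is id by simp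
lift_definition plus_permutation :: "'a permutation \<Rightarrow> 'a permutation \<Rightarrow> 'a permutation" is "\<lambda>f g x. f (g x)"
  using bij_comp unfolding o_def by blast
lift_definition uminus_permutation :: "'a permutation \<Rightarrow> 'a permutation" is "inv_into UNIV"
  by (simp add: bij_imp_bij_inv)
definition minus_permutation :: "'a permutation \<Rightarrow> 'a permutation \<Rightarrow> 'a permutation" where
  "minus_permutation p q = p + - q"
instance
proof
  fix p q r :: "'a permutation"
  show "p + q + r = p + (q + r)" by transfer simp
  show "0 + p = p" by transfer simp
  show "p + 0 = p" by transfer simp
  show "- p + p = 0" by transfer (simp add: fun_eq_iff bij_is_inj)
  show "p + - q = p - q" by (simp add: minus_permutation_def)
qed
end

text \<open>The left regular representation, extended by the identity outside the carrier to a
  bijection of the whole type. Foreign letters become 0, so that inversion of words is respected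
  without side conditions.\<close>

definition letter_perm :: "presentation \<Rightarrow> nat \<times> bool \<Rightarrow> word set permutation" where
  "letter_perm P l = (if [l] \<in> words P then Abs_permutation (\<lambda>C.
     if C \<in> carrier (pgroup P) then elt P [l] \<otimes>\<^bsub>pgroup P\<^esub> C else C) else 0)"

definition word_perm :: "presentation \<Rightarrow> word \<Rightarrow> word set permutation" where
  "word_perm P w = sum_list (map (letter_perm P) w)"

lemma word_perm_append [simp]: "word_perm P (u @ v) = word_perm P u + word_perm P v"
  and word_perm_Nil [simp]: "word_perm P [] = 0"
  by (simp_all add: word_perm_def)

lemma bij_left_mult:
  assumes "group G" "g \<in> carrier G"
  shows "bij (\<lambda>x. if x \<in> carrier G then g \<otimes>\<^bsub>G\<^esub> x else x)"
proof -
  interpret group G by fact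
  show ?thesis
    by (rule bij_betw_byWitness[where f' = "\<lambda>x. if x \<in> carrier G then inv\<^bsub>G\<^esub> g \<otimes>\<^bsub>G\<^esub> x else x"])
      (use assms(2) in \<open>auto simp: inv_solve_left' m_assoc[symmetric]\<close>)
qed

lemma Rep_letter_perm:
  assumes "wf_presentation P" "[l] \<in> words P"
  shows "Rep_permutation (letter_perm P l) C =
    (if C \<in> carrier (pgroup P) then elt P [l] \<otimes>\<^bsub>pgroup P\<^esub> C else C)"
  using assms bij_left_mult[OF group_pgroup[OF assms(1)] elt_closed[OF assms(2)]]
  by (simp add: letter_perm_def Abs_permutation_inverse)

lemma Rep_word_perm:
  assumes "wf_presentation P" "w \<in> words P"
  shows "Rep_permutation (word_perm P w) C =
    (if C \<in> carrier (pgroup P) then elt P w \<otimes>\<^bsub>pgroup P\<^esub> C else C)"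
  using assms(2)
proof (induction w)
  case Nil
  interpret group "pgroup P" using assms(1) by (rule group_pgroup)
  show ?case by (simp add: zero_permutation.rep_eq one_pgroup[symmetric])
next
  case (Cons l w)
  interpret group "pgroup P" using assms(1) by (rule group_pgroup)
  have l: "[l] \<in> words P" and w: "w \<in> words P"
    using Cons.prems words_append_iff[of "[l]" w P] by auto
  have "word_perm P (l # w) = letter_perm P l + word_perm P w"
    by (simp add: word_perm_def)
  then show ?case
    using mult_elt[OF assms(1) l w]
    by (simp add: plus_permutation.rep_eq Cons.IH[OF w] Rep_letter_perm[OF assms(1) l]
        elt_closed[OF l] elt_closed[OF w] m_assoc[symmetric])
qed

text \<open>Faithfulness of the regular representation: the permutation of a word sends the identity
  of the group to the class of the word.\<close>

lemma word_perm_eq_iff: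
  assumes "wf_presentation P" "u \<in> words P" "v \<in> words P"
  shows "word_perm P u = word_perm P v \<longleftrightarrow> elt P u = elt P v"
proof
  interpret group "pgroup P" using assms(1) by (rule group_pgroup)
  assume "word_perm P u = word_perm P v"
  then have "Rep_permutation (word_perm P u) \<one>\<^bsub>pgroup P\<^esub> = Rep_permutation (word_perm P v) \<one>\<^bsub>pgroup P\<^esub>"
    by simp
  then show "elt P u = elt P v"
    using assms by (simp add: Rep_word_perm elt_closed)
next
  assume "elt P u = elt P v"
  then show "word_perm P u = word_perm P v"
    using assms by (intro Rep_permutation_inject[THEN iffD1]) (auto simp: Rep_word_perm fun_eq_iff)
qed

lemma word_perm_inv_word:
  assumes "wf_presentation P"
  shows "word_perm P (inv_word w) = - word_perm P w"
proof (induction w)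
  case (Cons l w)
  have "letter_perm P (fst l, \<not> snd l) = - letter_perm P l"
  proof (cases "[l] \<in> words P")
    case True
    then have "word_perm P (inv_word [l] @ [l]) = 0"
      using word_perm_eq_iff[OF assms, of "inv_word [l] @ [l]" "[]"] word_eq_inv_left[OF True]
      by (simp add: inv_word_words elt_eq_iff[OF assms] del: word_perm_append)
    then show ?thesis
      by (simp add: inv_word_def word_perm_def eq_neg_iff_add_eq_0 split: prod.splits)
  next
    case False
    then have "[(fst l, \<not> snd l)] \<notin> words P" by (cases l) (auto simp: words_def)
    then show ?thesis using False by (simp add: letter_perm_def)
  qed
  moreover obtain x s where "l = (x, s)" by (cases l)
  ultimately show ?case using Cons
    by (simp add: inv_word_def word_perm_def minus_add)
qed (simp add: inv_word_def)

text \<open>The conjugator is a word, not an arbitrary permutation: the ambient type is far larger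
  than the image of the group.\<close>

lemma conjugate_word_perm_iff:
  assumes "wf_presentation P" "u \<in> words P" "v \<in> words P"
  shows "conjugate (pgroup P) (elt P u) (elt P v) \<longleftrightarrow>
    (\<exists>g\<in>words P. word_perm P v = - word_perm P g + word_perm P u + word_perm P g)"
proof -
  interpret group "pgroup P" using assms(1) by (rule group_pgroup)
  have "elt P v = inv\<^bsub>pgroup P\<^esub> elt P g \<otimes>\<^bsub>pgroup P\<^esub> elt P u \<otimes>\<^bsub>pgroup P\<^esub> elt P g \<longleftrightarrow>
      word_perm P v = - word_perm P g + word_perm P u + word_perm P g" if g: "g \<in> words P" for g
  proof -
    have "inv\<^bsub>pgroup P\<^esub> elt P g = elt P (inv_word g)"
      using g by (intro inv_equality)
        (simp_all add: mult_elt assms(1) inv_word_words elt_closed one_pgroup elt_eq_iff word_eq_inv_left)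
    then have "inv\<^bsub>pgroup P\<^esub> elt P g \<otimes>\<^bsub>pgroup P\<^esub> elt P u \<otimes>\<^bsub>pgroup P\<^esub> elt P g = elt P (inv_word g @ u @ g)"
      using g assms by (simp add: mult_elt inv_word_words)
    then show ?thesis
      using g assms word_perm_eq_iff[of P v "inv_word g @ u @ g"]
      by (simp add: inv_word_words word_perm_inv_word add.assoc)
  qed
  then show ?thesis
    by (auto simp: conjugate_def carrier_pgroup)
qed

definition power_word :: "word \<Rightarrow> int \<Rightarrow> word" where
  "power_word h k = concat (replicate (nat \<bar>k\<bar>) (if k \<ge> 0 then h else inv_word h))"

lemma power_word_words: "h \<in> words P \<Longrightarrow> power_word h k \<in> words P"
  using inv_word_words[of h P] by (auto simp: power_word_def words_def in_lists_conv_set split: if_splits)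

lemma elt_power_word:
  assumes "wf_presentation P" "h \<in> words P"
  shows "elt P (power_word h k) = elt P h [^]\<^bsub>pgroup P\<^esub> k"
proof -
  interpret group "pgroup P" using assms(1) by (rule group_pgroup)
  have nat: "elt P (concat (replicate n u)) = elt P u [^]\<^bsub>pgroup P\<^esub> n" if u: "u \<in> words P" for n u
  proof (induction n)
    case (Suc n)
    have "concat (replicate n u) \<in> words P" using u by (auto simp: words_def in_lists_conv_set)
    then show ?case using Suc u
      by (simp only: replicate_Suc concat.simps nat_pow_Suc2 elt_closed flip: mult_elt[OF assms(1)])
  qed (simp add: one_pgroup)
  have inv: "inv\<^bsub>pgroup P\<^esub> elt P h = elt P (inv_word h)"
    using assms by (intro inv_equality)
      (simp_all add: mult_elt inv_word_words elt_closed one_pgroup elt_eq_iff word_eq_inv_left)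
  show ?thesis
  proof (cases "k \<ge> 0")
    case True
    then have "power_word h k = concat (replicate (nat k) h)"
      by (simp add: power_word_def)
    moreover have "elt P h [^]\<^bsub>pgroup P\<^esub> k = elt P h [^]\<^bsub>pgroup P\<^esub> nat k"
      using True by (metis int_pow_int nat_0_le)
    ultimately show ?thesis using assms by (simp only: nat)
  next
    case False
    then have "power_word h k = concat (replicate (nat (- k)) (inv_word h))"
      by (simp add: power_word_def)
    then have "elt P (power_word h k) = inv\<^bsub>pgroup P\<^esub> (elt P h [^]\<^bsub>pgroup P\<^esub> nat (- k))"
      using assms by (simp only: nat inv_word_words inv[symmetric] nat_pow_inv elt_closed)
    also have "\<dots> = elt P h [^]\<^bsub>pgroup P\<^esub> k"
      using False unfolding int_pow_def2 by simp
    finally show ?thesis .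
  qed
qed

lemma word_perm_power_word_add:
  assumes "wf_presentation P" "h \<in> words P"
  shows "word_perm P (power_word h (k + m)) = word_perm P (power_word h k) + word_perm P (power_word h m)"
proof -
  interpret group "pgroup P" using assms(1) by (rule group_pgroup)
  have "elt P (power_word h (k + m)) = elt P (power_word h k @ power_word h m)"
    using int_pow_mult[OF elt_closed[OF assms(2)]]
      mult_elt[OF assms(1) power_word_words[OF assms(2)] power_word_words[OF assms(2)]]
    by (simp only: elt_power_word[OF assms])
  then show ?thesis
    using assms word_perm_eq_iff[of P "power_word h (k + m)" "power_word h k @ power_word h m"]
    by (simp add: power_word_words)
qed

section \<open>Normal forms in amalgamated products\<close>

definition alternating :: "(bool \<times> 'g) list \<Rightarrow> bool" where
  "alternating = successively (\<lambda>x y. fst x \<noteq> fst y)"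

lemma alternating_Nil [simp]: "alternating []"
  and alternating_Cons [simp]: "alternating (x # xs) \<longleftrightarrow> xs = [] \<or> fst x \<noteq> fst (hd xs) \<and> alternating xs"
  and alternating_append: "alternating (xs @ ys) \<longleftrightarrow> alternating xs \<and> alternating ys \<and>
    (xs = [] \<or> ys = [] \<or> fst (last xs) \<noteq> fst (hd ys))"
  by (auto simp: alternating_def successively_Cons successively_append_iff)

definition reduced :: "(bool \<Rightarrow> 'g set) \<Rightarrow> (bool \<Rightarrow> int \<Rightarrow> 'g) \<Rightarrow> (bool \<times> 'g) list \<Rightarrow> bool" where
  "reduced F e S \<longleftrightarrow> alternating S \<and> (\<forall>(i, x) \<in> set S. x \<in> F i \<and> x \<notin> range (e i))"

text \<open>
  Two groups with cyclic subgroups; \<open>e i\<close> lists the powers of the distinguished element of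
  \<open>F i\<close>. Van der Waerden's action is on pairs of an exponent \<open>k\<close> and an alternating list of
  representatives of right cosets of the cyclic subgroups, which stand for normal forms.
\<close>

locale amalgamated_factors =
  fixes F :: "bool \<Rightarrow> 'f::group_add set" and e :: "bool \<Rightarrow> int \<Rightarrow> 'f"
  assumes F_add: "x \<in> F i \<Longrightarrow> y \<in> F i \<Longrightarrow> x + y \<in> F i"
    and F_uminus: "x \<in> F i \<Longrightarrow> - x \<in> F i"
    and e_in: "e i k \<in> F i"
    and e_add: "e i (k + m) = e i k + e i m"
    and e_compat: "e i k = e i m \<longleftrightarrow> e j k = e j m"
begin

section \<open>Cosets of the cyclic subgroups and canonical exponents\<close>

lemma e_zero: "e i 0 = 0"
  using e_add[of i 0 0] add_left_cancel[of "e i 0" "e i 0" 0] by simp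

lemma e_uminus: "e i (- k) = - e i k"
  using e_add[of i "- k" k] by (simp add: e_zero eq_neg_iff_add_eq_0)

text \<open>The choice predicate depends only on the right coset of \<open>g\<close>, hence so does
  the representative. The subgroup itself is represented by 0, which lets \<open>join_head\<close>
  recognise a syllable that has to disappear.\<close>

definition rep :: "bool \<Rightarrow> 'f \<Rightarrow> 'f" where
  "rep i g = (if g \<in> range (e i) then 0 else SOME x. \<exists>k. g = e i k + x)"

text \<open>Exponents are counted modulo the common order of the two distinguished elements.\<close>

definition canon :: "int \<Rightarrow> int" where
  "canon k = (SOME m. e True m = e True k)"

definition head_exp :: "bool \<Rightarrow> 'f \<Rightarrow> int" where
  "head_exp i g = canon (SOME k. g = e i k + rep i g)"

lemma rep_decomp: "\<exists>k. g = e i k + rep i g"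
proof (cases "g \<in> range (e i)")
  case False
  have "\<exists>x k. g = e i k + x"
    by (rule exI[of _ g], rule exI[of _ 0]) (simp add: e_zero)
  from someI_ex[OF this] show ?thesis using False by (simp add: rep_def)
qed (auto simp: rep_def)

lemma e_add_mem_range_iff: "e i k + g \<in> range (e i) \<longleftrightarrow> g \<in> range (e i)"
proof
  assume "e i k + g \<in> range (e i)"
  then obtain m where "e i k + g = e i m" by auto
  then have "g = e i (- k) + e i m" by (metis e_uminus minus_add_cancel)
  then show "g \<in> range (e i)" by (metis e_add rangeI)
next
  assume "g \<in> range (e i)"
  then show "e i k + g \<in> range (e i)" by (metis e_add rangeE rangeI)
qed

lemma rep_e_add: "rep i (e i k + g) = rep i g"
proof -
  have "(\<exists>m. e i k + g = e i m + x) \<longleftrightarrow> (\<exists>m. g = e i m + x)" for x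
  proof
    assume "\<exists>m. e i k + g = e i m + x"
    then obtain m where "e i k + g = e i m + x" by auto
    then have "g = e i (- k + m) + x" by (metis add.assoc e_add e_uminus minus_add_cancel)
    then show "\<exists>m. g = e i m + x" by blast
  next
    assume "\<exists>m. g = e i m + x"
    then show "\<exists>m. e i k + g = e i m + x" by (metis add.assoc e_add)
  qed
  then show ?thesis by (simp add: rep_def e_add_mem_range_iff)
qed

lemma rep_eq_0_iff: "rep i g = 0 \<longleftrightarrow> g \<in> range (e i)"
  using rep_decomp[of g i] by (auto simp: rep_def)

lemma rep_rep: "rep i (rep i g) = rep i g"
  by (metis rep_decomp rep_e_add)

lemma rep_in: "g \<in> F i \<Longrightarrow> rep i g \<in> F i"
  by (metis F_add F_uminus e_in minus_add_cancel rep_decomp)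

lemma e_canon: "e i (canon k) = e i k"
proof -
  have "e True (canon k) = e True k"
    unfolding canon_def by (rule someI[of _ k]) simp
  then show ?thesis using e_compat by blast
qed

lemma canon_cong: "e i k = e i m \<Longrightarrow> canon k = canon m"
  unfolding canon_def using e_compat[of i k m True] by simp

lemma canon_canon: "canon (canon k) = canon k"
  by (rule canon_cong[of True]) (rule e_canon)

lemma head_exp_decomp: "e i (head_exp i g) + rep i g = g"
proof -
  have "g = e i (SOME k. g = e i k + rep i g) + rep i g"
    by (rule someI_ex[OF rep_decomp])
  then show ?thesis by (simp add: head_exp_def e_canon)
qed

lemma head_exp_e_add:
  assumes "rep i t = t"
  shows "head_exp i (e i k + t) = canon k"
proof -
  have "e i (head_exp i (e i k + t)) + t = e i k + t"
    using head_exp_decomp[of i "e i k + t"] assms by (simp add: rep_e_add)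
  then have "e i (head_exp i (e i k + t)) = e i k" by simp
  from canon_cong[OF this] show ?thesis by (simp add: head_exp_def canon_canon)
qed

section \<open>Normal forms and van der Waerden's action on them\<close>

definition normal_tail :: "(bool \<times> 'f) list \<Rightarrow> bool" where
  "normal_tail ts \<longleftrightarrow> alternating ts \<and> (\<forall>(i, t) \<in> set ts. t \<in> F i \<and> t \<noteq> 0 \<and> rep i t = t)"

definition normal :: "int \<times> (bool \<times> 'f) list \<Rightarrow> bool" where
  "normal x \<longleftrightarrow> canon (fst x) = fst x \<and> normal_tail (snd x)"

definition tail_for :: "bool \<Rightarrow> (bool \<times> 'f) list \<Rightarrow> bool" where
  "tail_for i r \<longleftrightarrow> normal_tail r \<and> (r = [] \<or> fst (hd r) \<noteq> i)"

text \<open>The pair \<open>(k, ts)\<close> stands for the power e^k followed by the representatives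
  in \<open>ts\<close>. Here its longest prefix inside factor \<open>i\<close> is gathered into one
  element; \<open>join_head\<close> undoes this.\<close>

definition split_head :: "bool \<Rightarrow> int \<times> (bool \<times> 'f) list \<Rightarrow> 'f \<times> (bool \<times> 'f) list" where
  "split_head i x = (case snd x of [] \<Rightarrow> (e i (fst x), []) | (j, t) # r \<Rightarrow>
     if j = i then (e i (fst x) + t, r) else (e i (fst x), (j, t) # r))"

definition join_head :: "bool \<Rightarrow> 'f \<Rightarrow> (bool \<times> 'f) list \<Rightarrow> int \<times> (bool \<times> 'f) list" where
  "join_head i y r = (head_exp i y, if rep i y = 0 then r else (i, rep i y) # r)"

text \<open>Left translation on the prefix in factor \<open>i\<close>, transported along the
  mutually inverse maps \<open>split_head\<close> and \<open>join_head\<close>; the laws of an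
  action follow at once.\<close>

definition act :: "bool \<Rightarrow> 'f \<Rightarrow> int \<times> (bool \<times> 'f) list \<Rightarrow> int \<times> (bool \<times> 'f) list" where
  "act i g x = join_head i (g + fst (split_head i x)) (snd (split_head i x))"

lemma split_head_mem:
  assumes "normal x"
  shows "fst (split_head i x) \<in> F i" "tail_for i (snd (split_head i x))"
  using assms by (auto simp: split_head_def normal_def normal_tail_def tail_for_def F_add e_in
      split: list.splits)

lemma normal_join_head: "y \<in> F i \<Longrightarrow> tail_for i r \<Longrightarrow> normal (join_head i y r)"
  by (auto simp: join_head_def normal_def normal_tail_def tail_for_def rep_in rep_rep
      head_exp_def canon_canon)

lemma join_split_head:
  assumes "normal x"
  shows "join_head i (fst (split_head i x)) (snd (split_head i x)) = x"
proof -
  obtain k ts where x: "x = (k, ts)" by (cases x)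
  have k: "canon k = k" using assms by (simp add: x normal_def)
  \<comment> \<open>A bare power is the case of the representative 0.\<close>
  have "rep i 0 = 0" by (simp add: rep_eq_0_iff) (metis e_zero rangeI)
  then have "join_head i (e i k) r = (k, r)" for r
    using head_exp_e_add[of i 0 k] rep_e_add[of i k 0] k by (simp add: join_head_def)
  moreover have "join_head i (e i k + t) r = (k, (i, t) # r)" if "rep i t = t" "t \<noteq> 0" for t r
    using head_exp_e_add[of i t k] that k by (simp add: join_head_def rep_e_add)
  ultimately show ?thesis
    using assms by (auto simp: x split_head_def normal_def normal_tail_def split: list.splits)
qed

lemma split_join_head:
  assumes "tail_for i r"
  shows "split_head i (join_head i y r) = (y, r)"
  using assms head_exp_decomp[of i y]
  by (auto simp: join_head_def split_head_def tail_for_def split: list.splits)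

lemma normal_act: "g \<in> F i \<Longrightarrow> normal x \<Longrightarrow> normal (act i g x)"
  by (simp add: act_def normal_join_head split_head_mem F_add)

lemma act_add: "normal x \<Longrightarrow> act i (g + h) x = act i g (act i h x)"
  by (simp add: act_def split_join_head split_head_mem add.assoc)

lemma act_0: "normal x \<Longrightarrow> act i 0 x = x"
  by (simp add: act_def join_split_head)

text \<open>The result does not depend on \<open>i\<close>: both factors act alike through the
  amalgamated subgroup, which is what the amalgamation relator demands.\<close>

lemma act_e:
  assumes "normal x"
  shows "act i (e i m) x = (canon (m + fst x), snd x)"
proof -
  have "split_head i (canon (m + fst x), snd x) = (e i m + fst (split_head i x), snd (split_head i x))"
    by (auto simp: split_head_def e_canon e_add add.assoc split: list.splits)
  moreover have "normal (canon (m + fst x), snd x)"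
    using assms by (simp add: normal_def canon_canon)
  ultimately show ?thesis
    using join_split_head[of "(canon (m + fst x), snd x)" i] by (simp add: act_def)
qed

text \<open>The action of each factor is free, since \<open>split_head\<close> recovers the
  translated prefix. This is what later embeds the factors.\<close>

lemma act_inj:
  assumes "normal x" "act i g x = act i h x"
  shows "g = h"
proof -
  have "split_head i (act i g x) = split_head i (act i h x)" using assms by simp
  then show ?thesis using assms(1) by (simp add: act_def split_join_head split_head_mem)
qed

lemma normal_canon: "normal (canon k, [])"
  by (simp add: normal_def normal_tail_def canon_canon)

text \<open>Each syllable adds exactly one representative in front: the tail built so far starts in
  the other factor, so its prefix in factor \<open>i\<close> is a mere power, and a power cannot
  bring \<open>g\<close> into the subgroup.\<close>

lemma act_reduced:
  assumes "reduced F e S"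
  shows "normal (foldr (\<lambda>(i, g). act i g) S (canon k, []))"
    and "map fst (snd (foldr (\<lambda>(i, g). act i g) S (canon k, []))) = map fst S"
proof -
  have "normal (foldr (\<lambda>(i, g). act i g) S (canon k, [])) \<and>
      map fst (snd (foldr (\<lambda>(i, g). act i g) S (canon k, []))) = map fst S"
    using assms(1)
  proof (induction S)
    case Nil
    then show ?case by (simp add: normal_canon)
  next
    case (Cons p S)
    obtain i g where p: "p = (i, g)" by (cases p)
    define y where "y = foldr (\<lambda>(i, g). act i g) S (canon k, [])"
    have y: "normal y" "map fst (snd y) = map fst S" and g: "g \<in> F i" "g \<notin> range (e i)"
      using Cons by (auto simp: y_def reduced_def p)
    have "S = [] \<or> fst (hd S) \<noteq> i"
      using Cons.prems by (auto simp: reduced_def p)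
    then have "snd y = [] \<or> fst (hd (snd y)) \<noteq> i"
      using y(2) by (cases S; cases "snd y") auto
    then have split: "split_head i y = (e i (fst y), snd y)"
      by (auto simp: split_head_def split: list.splits)
    have "g + e i (fst y) \<notin> range (e i)"
    proof
      assume "g + e i (fst y) \<in> range (e i)"
      then obtain m where "g + e i (fst y) = e i m" by auto
      then have "g = e i (m - fst y)"
        using e_add[of i "m - fst y" "fst y"] add_right_cancel[of g "e i (fst y)" "e i (m - fst y)"]
        by simp
      then show False using g by blast
    qed
    then have "map fst (snd (act i g y)) = i # map fst S"
      by (simp add: act_def split join_head_def rep_eq_0_iff y)
    then show ?case using normal_act[OF g(1) y(1)] by (simp add: p flip: y_def)
  qed
  then show "normal (foldr (\<lambda>(i, g). act i g) S (canon k, []))"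
    and "map fst (snd (foldr (\<lambda>(i, g). act i g) S (canon k, []))) = map fst S" by simp_all
qed

end

section \<open>Conjugacy in amalgamated products\<close>

definition prd :: "(bool \<times> 'g::group_add) list \<Rightarrow> 'g" where
  "prd S = sum_list (map snd S)"

lemma prd_Nil [simp]: "prd [] = 0"
  and prd_Cons [simp]: "prd (p # S) = snd p + prd S"
  and prd_append [simp]: "prd (S @ T) = prd S + prd T"
  by (simp_all add: prd_def)

definition inv_syllables :: "(bool \<times> 'g::group_add) list \<Rightarrow> (bool \<times> 'g) list" where
  "inv_syllables S = rev (map (apsnd uminus) S)"

lemma prd_inv_syllables: "prd (inv_syllables S) = - prd S"
  by (induction S) (auto simp: inv_syllables_def minus_add)

lemma inv_syllables_Nil [simp]: "inv_syllables [] = []"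
  by (simp add: inv_syllables_def)

lemma map_fst_inv_syllables: "map fst (inv_syllables S) = rev (map fst S)"
  by (simp add: inv_syllables_def rev_map o_def)

lemma alternating_map_fst: "map fst S = map fst T \<Longrightarrow> alternating S = alternating T"
  using successively_map[of "(\<noteq>)" fst S] successively_map[of "(\<noteq>)" fst T]
  by (simp add: alternating_def)

lemma alternating_rev: "alternating (rev S) = alternating S"
  unfolding alternating_def successively_rev
  by (rule arg_cong[where f = "\<lambda>P. successively P S"]) (auto simp: fun_eq_iff)

lemma alternating_inv_syllables: "alternating (inv_syllables S) = alternating S"
  using alternating_map_fst[of "inv_syllables S" "rev S"]
  by (simp add: map_fst_inv_syllables alternating_rev rev_map)

text \<open>Rewriting to freely reduced normal form in noncommutative additive groups.\<close>

lemmas group_normalize = diff_conv_add_uminus minus_add minus_minus add.assoc minus_add_cancel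
  add_minus_cancel left_minus right_minus add_0_left add_0_right minus_zero

text \<open>Both factors now sit in one group and share one family \<open>e\<close>. Of the action
  only \<open>normal_form\<close> is retained, the invariance of the sequence of factors visited;
  \<open>e_conj\<close> is non-self-conjugacy inside each factor.\<close>

locale amalgamated_group =
  fixes F :: "bool \<Rightarrow> 'g::group_add set" and e :: "int \<Rightarrow> 'g"
  assumes F_add: "x \<in> F i \<Longrightarrow> y \<in> F i \<Longrightarrow> x + y \<in> F i"
    and F_uminus: "x \<in> F i \<Longrightarrow> - x \<in> F i"
    and e_in: "e k \<in> F i"
    and e_add: "e (k + m) = e k + e m"
    and normal_form: "reduced F (\<lambda>_. e) S \<Longrightarrow> reduced F (\<lambda>_. e) T \<Longrightarrow>
      e k + prd S = e m + prd T \<Longrightarrow> map fst S = map fst T"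
    and e_conj: "g \<in> F i \<Longrightarrow> e m = - g + e k + g \<Longrightarrow> e k = e m"
begin

abbreviation "red \<equiv> reduced F (\<lambda>_. e)"

lemma e_zero [simp]: "e 0 = 0"
  using e_add[of 0 0] add_left_cancel[of "e 0" "e 0" 0] by simp

lemma e_uminus: "e (- k) = - e k"
  using e_add[of "- k" k] by (simp add: eq_neg_iff_add_eq_0)

lemma zero_in: "0 \<in> F i"
  using e_in[of 0 i] by simp

lemma e_add_mem_range_iff [simp]: "e k + x \<in> range e \<longleftrightarrow> x \<in> range e"
proof
  assume "e k + x \<in> range e"
  then obtain m where "e k + x = e m" by auto
  then have "x = e (- k + m)" by (metis e_add e_uminus minus_add_cancel)
  then show "x \<in> range e" by blast
qed (metis e_add rangeE rangeI)

lemma uminus_mem_range_iff [simp]: "- x \<in> range e \<longleftrightarrow> x \<in> range e"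
  by (metis e_uminus minus_minus rangeE rangeI)

lemma add_e_mem_range_iff [simp]: "x + e k \<in> range e \<longleftrightarrow> x \<in> range e"
  using e_add_mem_range_iff[of "- k" "- x"] uminus_mem_range_iff[of "x + e k"]
  by (simp add: minus_add e_uminus del: e_add_mem_range_iff uminus_mem_range_iff)
    (metis uminus_mem_range_iff)

lemma red_Nil [simp]: "red []"
  by (simp add: reduced_def)

lemma red_append:
  "red (S @ T) \<longleftrightarrow> red S \<and> red T \<and> (S = [] \<or> T = [] \<or> fst (last S) \<noteq> fst (hd T))"
  by (auto simp: reduced_def alternating_append)

lemma red_single: "red [(i, x)] \<longleftrightarrow> x \<in> F i \<and> x \<notin> range e"
  by (simp add: reduced_def)

lemma red_Cons:
  "red ((i, x) # S) \<longleftrightarrow> x \<in> F i \<and> x \<notin> range e \<and> red S \<and> (S = [] \<or> i \<noteq> fst (hd S))"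
  using red_append[of "[(i, x)]" S] by (auto simp: red_single)

lemma red_inv_syllables:
  assumes "red S"
  shows "red (inv_syllables S)"
proof -
  have "x \<in> F i \<and> x \<notin> range e" if ix: "(i, x) \<in> set (inv_syllables S)" for i x
  proof -
    obtain y where "(i, y) \<in> set S" "x = - y" using ix by (force simp: inv_syllables_def)
    then show ?thesis using assms F_uminus[of y] uminus_mem_range_iff[of y] by (auto simp: reduced_def)
  qed
  then show ?thesis using assms by (auto simp: reduced_def alternating_inv_syllables)
qed

lemma red_not_e: "red S \<Longrightarrow> prd S = e k \<Longrightarrow> S = []"
  using normal_form[of S "[]" 0 k] by simp

text \<open>Otherwise one element would be a reduced product in two ways, with factor sequences
  \<open>[True]\<close> and \<open>[False]\<close>.\<close>

lemma mem_both:
  assumes "x \<in> F True" "x \<in> F False"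
  shows "x \<in> range e"
proof (rule ccontr)
  assume "x \<notin> range e"
  then have "red [(True, x)]" "red [(False, x)]" using assms by (simp_all add: red_single)
  from normal_form[OF this, of 0 0] show False by simp
qed

lemma mem_two: "x \<in> F i \<Longrightarrow> x \<in> F j \<Longrightarrow> i \<noteq> j \<Longrightarrow> x \<in> range e"
  using mem_both by (cases i; cases j) auto

section \<open>Reduced products\<close>

definition syllables :: "(bool \<times> 'g) list \<Rightarrow> bool" where
  "syllables L \<longleftrightarrow> (\<forall>(i, x) \<in> set L. x \<in> F i)"

lemma syllables_inv_syllables: "syllables L \<Longrightarrow> syllables (inv_syllables L)"
  by (auto simp: syllables_def inv_syllables_def F_uminus)

text \<open>The surplus power is carried at the right end, where the next syllable absorbs it as
  \<open>z\<close>. It also stands there next to the element being conjugated when syllables are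
  peeled off later.\<close>

lemma reduced_form:
  assumes "syllables L"
  shows "\<exists>S k. red S \<and> prd L = prd S + e k"
  using assms
proof (induction L rule: rev_induct)
  case Nil
  show ?case by (rule exI[of _ "[]"], rule exI[of _ 0]) simp
next
  case (snoc p L)
  obtain i x where p: "p = (i, x)" by (cases p)
  have "syllables L" and x: "x \<in> F i" using snoc.prems by (auto simp: syllables_def p)
  with snoc.IH obtain S k where S: "red S" "prd L = prd S + e k" by blast
  define z where "z = e k + x"
  have z: "z \<in> F i" using x by (simp add: z_def F_add e_in)
  have eq: "prd (L @ [p]) = prd S + z" using S by (simp add: p z_def add.assoc)
  show ?case
  proof (cases "S \<noteq> [] \<and> fst (last S) = i")
    case True
    then obtain S' y where S': "S = S' @ [(i, y)]"
      by (cases S rule: rev_cases) auto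
    have yz: "y + z \<in> F i" using S S' z by (auto simp: red_append red_single F_add)
    show ?thesis
    proof (cases "y + z \<in> range e")
      case True
      then obtain m where "y + z = e m" by auto
      then show ?thesis using S S' eq
        by (intro exI[of _ S'] exI[of _ m]) (auto simp: red_append add.assoc)
    next
      case False
      then show ?thesis using S S' eq yz
        by (intro exI[of _ "S' @ [(i, y + z)]"] exI[of _ 0]) (auto simp: red_append red_single add.assoc)
    qed
  next
    case S_end: False
    show ?thesis
    proof (cases "z \<in> range e")
      case True
      then show ?thesis using S eq by blast
    next
      case False
      then show ?thesis using S eq z S_end
        by (intro exI[of _ "S @ [(i, z)]"] exI[of _ 0]) (auto simp: red_append red_single)
    qed
  qed
qed

text \<open>Around a middle part \<open>M\<close> that begins and ends in factor \<open>j\<close>,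
  nothing cancels. The syllable \<open>(j, c)\<close> records that \<open>G\<close> does not end in
  factor \<open>j\<close>.\<close>

lemma red_conjugated:
  assumes "red M" "M \<noteq> []" "fst (hd M) = j" "fst (last M) = j" "red (G @ [(j, c)])"
  shows "red (G @ M @ inv_syllables G)"
    and "fst (hd (G @ M @ inv_syllables G)) = fst (last (G @ M @ inv_syllables G))"
proof -
  have G: "red G" "G = [] \<or> fst (last G) \<noteq> j" using assms(5) by (auto simp: red_append)
  have "red (G @ M @ inv_syllables G) \<and>
    fst (hd (G @ M @ inv_syllables G)) = fst (last (G @ M @ inv_syllables G))"
  proof (cases "G = []")
    case False
    then have "inv_syllables G \<noteq> []" "fst (hd (inv_syllables G)) = fst (last G)"
      "fst (last (inv_syllables G)) = fst (hd G)"
      by (simp_all add: inv_syllables_def hd_rev last_rev last_map hd_map)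
    then show ?thesis
      using assms(1-4) G False red_inv_syllables[OF G(1)] by (auto simp: red_append)
  qed (use assms in auto)
  then show "red (G @ M @ inv_syllables G)"
    and "fst (hd (G @ M @ inv_syllables G)) = fst (last (G @ M @ inv_syllables G))" by simp_all
qed

section \<open>Solitar's theorem for cyclically reduced products\<close>

definition cred :: "(bool \<times> 'g) list \<Rightarrow> bool" where
  "cred S \<longleftrightarrow> red S \<and> S \<noteq> [] \<and> fst (hd S) \<noteq> fst (last S)"

text \<open>Equal values force equal factor sequences, and only those of \<open>L\<close> have
  matching ends.\<close>

lemma cred_not_conjugated:
  assumes "cred S" "red L" "L \<noteq> []" "fst (hd L) = fst (last L)" "prd S = prd L"
  shows False
proof -
  have "map fst S = map fst L"
    using normal_form[of S L 0 0] assms by (simp add: cred_def)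
  then have "fst (hd S) = fst (hd L)" "fst (last S) = fst (last L)"
    using assms(1,3) by (metis cred_def hd_map, metis cred_def last_map)
  then show False using assms by (simp add: cred_def)
qed

text \<open>The innermost conjugating syllable meets \<open>T\<close> on one side only, as the ends
  of \<open>T\<close> lie in different factors. Were it not to cancel an end syllable of
  \<open>T\<close> up to a power, the conjugate would be reduced with equal ends, contrary to
  \<open>cred S\<close>. So each peeled syllable merely rotates \<open>T\<close> by one place;
  \<open>T\<close> and \<open>l\<close> vary accordingly in the induction.\<close>

lemma cred_conj_aux:
  assumes "red G" "cred T" "cred S" "prd S = (prd G + e l) + prd T + - (prd G + e l)"
  shows "\<exists>n k. prd S = e k + prd (rotate n T) + - e k"
  using assms(1,2,4)
proof (induction G arbitrary: T l rule: rev_induct)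
  case Nil
  then show ?case by (intro exI[of _ 0] exI[of _ l]) simp
next
  case (snoc p G)
  obtain j y0 where p: "p = (j, y0)" by (cases p)
  \<comment> \<open>The surplus power is absorbed into the innermost syllable.\<close>
  define y where "y = y0 + e l"
  have G: "red G" and Gy: "red (G @ [(j, y)])" and y: "y \<in> F j" "y \<notin> range e"
    using snoc.prems(1) by (auto simp: p y_def red_append red_single F_add e_in)
  have S_eq: "prd S = prd G + y + prd T + - y + - prd G"
    using snoc.prems(3) by (simp only: p y_def prd_append prd_Cons prd_Nil snd_conv group_normalize)
  \<comment> \<open>With only two factors, the distinct ends of \<open>T\<close> occupy both, so one
    of them is in factor \<open>j\<close>.\<close>
  consider (last) "fst (last T) = j" | (first) "fst (hd T) = j"
    using snoc.prems(2) unfolding cred_def by (cases j) blast+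
  then show ?case
  proof cases
    case last
    then obtain T' q where T: "T = T' @ [(j, q)]"
      using snoc.prems(2) by (cases T rule: rev_cases) (auto simp: cred_def)
    have T': "red T'" "T' \<noteq> []" "fst (hd T') \<noteq> j" "q \<in> F j" "q \<notin> range e" "fst (last T') \<noteq> j"
      using snoc.prems(2) by (auto simp: T cred_def red_append red_single hd_append split: if_splits)
    have "q + - y \<in> range e"
    proof (rule ccontr)
      assume "q + - y \<notin> range e"
      moreover have "q + - y \<in> F j" using T' y F_add F_uminus by blast
      ultimately have M: "red ((j, y) # T' @ [(j, q + - y)])"
        using T' y by (simp add: red_append red_single red_Cons del: add_uminus_conv_diff)
      let ?L = "G @ ((j, y) # T' @ [(j, q + - y)]) @ inv_syllables G"
      have "prd S = prd ?L"
        by (simp only: S_eq T prd_append prd_Cons prd_Nil snd_conv prd_inv_syllables group_normalize)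
      then show False
        using red_conjugated[OF M _ _ _ Gy] cred_not_conjugated[OF assms(3), of ?L] by simp
    qed
    then obtain m where "q + - y = e m" by auto
    then have "y = e (- m) + q"
      by (metis add_uminus_conv_diff e_uminus minus_add_cancel minus_diff_eq diff_add_cancel)
    then have "prd S = (prd G + e (- m)) + prd ((j, q) # T') + - (prd G + e (- m))"
      by (simp only: S_eq T prd_append prd_Cons prd_Nil snd_conv group_normalize)
    moreover have "cred ((j, q) # T')"
      using T' by (auto simp: cred_def red_Cons)
    ultimately obtain n k where nk: "prd S = e k + prd (rotate n ((j, q) # T')) + - e k"
      using snoc.IH[OF G] by blast
    \<comment> \<open>Moving the last syllable to the front is a rotation by the length of the
      remaining part.\<close>
    have "(j, q) # T' = rotate (length T') T"
      by (simp add: T rotate_append)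
    from nk[unfolded this rotate_rotate] show ?thesis by blast
  next
    case first
    have "T \<noteq> []" using snoc.prems(2) by (simp add: cred_def)
    define q where "q = snd (hd T)"
    define T' where "T' = tl T"
    have "hd T = (j, q)" by (simp add: q_def prod_eq_iff first)
    then have T: "T = (j, q) # T'"
      using \<open>T \<noteq> []\<close> by (cases T) (auto simp: T'_def)
    have T': "red T'" "T' \<noteq> []" "fst (hd T') \<noteq> j" "q \<in> F j" "q \<notin> range e" "fst (last T') \<noteq> j"
      using snoc.prems(2) by (auto simp: T cred_def red_Cons split: if_splits)
    have "y + q \<in> range e"
    proof (rule ccontr)
      assume "y + q \<notin> range e"
      moreover have "y + q \<in> F j" using T' y F_add by blast
      ultimately have M: "red ((j, y + q) # T' @ [(j, - y)])"
        using T' y by (simp add: red_append red_single red_Cons F_uminus)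
      let ?L = "G @ ((j, y + q) # T' @ [(j, - y)]) @ inv_syllables G"
      have "prd S = prd ?L"
        by (simp only: S_eq T prd_append prd_Cons prd_Nil snd_conv prd_inv_syllables group_normalize)
      then show False
        using red_conjugated[OF M _ _ _ Gy] cred_not_conjugated[OF assms(3), of ?L] by simp
    qed
    then obtain m where "y + q = e m" by auto
    then have "y = e m + - q" by (metis add_diff_cancel add_uminus_conv_diff)
    then have "prd S = (prd G + e m) + prd (T' @ [(j, q)]) + - (prd G + e m)"
      by (simp only: S_eq T prd_append prd_Cons prd_Nil snd_conv group_normalize)
    moreover have "cred (T' @ [(j, q)])"
      using T' by (auto simp: cred_def red_append red_single)
    ultimately obtain n k where nk: "prd S = e k + prd (rotate n (T' @ [(j, q)])) + - e k"
      using snoc.IH[OF G] by blast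
    have "T' @ [(j, q)] = rotate 1 T" by (simp add: T)
    from nk[unfolded this rotate_rotate] show ?thesis by blast
  qed
qed

section \<open>Conjugates of elements of the factors\<close>

definition fconj :: "bool \<Rightarrow> 'g \<Rightarrow> 'g \<Rightarrow> bool" where
  "fconj i x y \<longleftrightarrow> (\<exists>g\<in>F i. y = - g + x + g)"

lemma fconj_refl: "fconj i x x"
  unfolding fconj_def by (rule bexI[of _ 0]) (auto simp: zero_in)

lemma fconj_sym:
  assumes "fconj i x y"
  shows "fconj i y x"
proof -
  obtain g where g: "g \<in> F i" "y = - g + x + g" using assms by (auto simp: fconj_def)
  then have "x = - (- g) + y + - g" by (simp only: group_normalize)
  then show ?thesis unfolding fconj_def using g F_uminus by blast
qed

lemma fconj_trans:
  assumes "fconj i x y" "fconj i y z"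
  shows "fconj i x z"
proof -
  obtain g h where g: "g \<in> F i" "y = - g + x + g" and h: "h \<in> F i" "z = - h + y + h"
    using assms by (auto simp: fconj_def)
  then have "z = - (g + h) + x + (g + h)" by (simp only: group_normalize)
  then show ?thesis unfolding fconj_def using g h F_add by blast
qed

lemma fconj_e: "fconj i (e k) (e m) \<Longrightarrow> e k = e m"
  using e_conj by (auto simp: fconj_def)

text \<open>One intermediate power replaces Solitar's chain, because conjugate powers are equal by
  \<open>e_conj\<close>.\<close>

definition short_conj :: "bool \<Rightarrow> 'g \<Rightarrow> bool \<Rightarrow> 'g \<Rightarrow> bool" where
  "short_conj i x j y \<longleftrightarrow> i = j \<and> fconj i x y \<or> (\<exists>k. fconj i x (e k) \<and> fconj j y (e k))"

lemma short_conj_fconj: "fconj i x x' \<Longrightarrow> short_conj i x' j w \<Longrightarrow> short_conj i x j w"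
  unfolding short_conj_def using fconj_trans by blast

text \<open>A power belongs to both factors and may change sides, hence the free index
  \<open>i\<close> in the conclusion.\<close>

lemma short_conj_e:
  assumes "fconj j (e k) x'" "short_conj j x' j' w"
  shows "short_conj i (e k) j' w"
proof -
  consider "j = j'" "fconj j x' w" | m where "fconj j x' (e m)" "fconj j' w (e m)"
    using assms(2) unfolding short_conj_def by blast
  then show ?thesis
  proof cases
    case 1
    then have "fconj j' w (e k)" using assms(1) fconj_sym fconj_trans by blast
    then show ?thesis using fconj_refl short_conj_def by blast
  next
    case 2
    then have "e k = e m" using assms(1) fconj_trans fconj_e by blast
    then have "fconj i (e k) (e m)" using fconj_refl by simp
    then show ?thesis using 2 short_conj_def by blast
  qed
qed

text \<open>Peel off the innermost conjugating syllable \<open>y\<close>. If it lies in the factor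
  of \<open>x\<close>, it replaces \<open>x\<close> by a conjugate there; if \<open>x\<close> is a
  power, it moves \<open>x\<close> into the factor of \<open>y\<close>; otherwise y x y^(-1) is
  reduced and the outer syllables cannot cancel either, which gives the first alternative.\<close>

lemma short_conj_aux:
  assumes "red G" "x \<in> F i" "w = (prd G + e l) + x + - (prd G + e l)"
  shows "(\<exists>L. red L \<and> length L \<ge> 2 \<and> fst (hd L) = fst (last L) \<and> w = prd L) \<or>
    (\<exists>j. w \<in> F j \<and> short_conj i x j w)"
  using assms
proof (induction G arbitrary: x i l rule: rev_induct)
  case Nil
  \<comment> \<open>Powers lie in every factor, so conjugating by \<open>e l\<close> stays inside
    factor \<open>i\<close>.\<close>
  then have w: "w = - (- e l) + x + - e l" by (simp only: group_normalize prd_Nil)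
  then have "w \<in> F i" using Nil by (simp only: F_add F_uminus e_in)
  moreover have "fconj i x w" unfolding fconj_def using w F_uminus e_in by blast
  ultimately show ?case by (auto simp: short_conj_def)
next
  case (snoc p G)
  obtain j y0 where p: "p = (j, y0)" by (cases p)
  define y where "y = y0 + e l"
  have G: "red G" and Gy: "red (G @ [(j, y)])" and y: "y \<in> F j" "y \<notin> range e"
    using snoc.prems(1) by (auto simp: p y_def red_append red_single F_add e_in)
  have w_eq: "w = prd G + y + x + - y + - prd G"
    using snoc.prems(3) by (simp only: p y_def prd_append prd_Cons prd_Nil snd_conv group_normalize)
  have w_eq': "w = (prd G + e 0) + (y + x + - y) + - (prd G + e 0)"
    by (simp only: w_eq group_normalize e_zero)
  have conj_y: "y + z + - y \<in> F j" "fconj j z (y + z + - y)" if "z \<in> F j" for z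
  proof -
    show "y + z + - y \<in> F j" using that y F_add F_uminus by blast
    have "y + z + - y = - (- y) + z + - y" by (simp only: minus_minus)
    then show "fconj j z (y + z + - y)" unfolding fconj_def using y F_uminus by blast
  qed
  show ?case
  proof (cases "j = i")
    case True
    then have x: "x \<in> F j" using snoc.prems(2) by simp
    from snoc.IH[OF G conj_y(1)[OF x] w_eq'] show ?thesis
      using short_conj_fconj[OF conj_y(2)[OF x]] True by blast
  next
    case ji: False
    show ?thesis
    proof (cases "x \<in> range e")
      case True
      then obtain k where k: "x = e k" by auto
      note z = conj_y[OF e_in, of k]
      have "short_conj i x j' w" if "short_conj j (y + x + - y) j' w" for j'
        using short_conj_e[OF _ that] z(2) k by blast
      moreover have "y + x + - y \<in> F j" using z(1) k by simp
      ultimately show ?thesis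
        using snoc.IH[OF G _ w_eq', of j] by blast
    next
      case False
      have M: "red [(j, y), (i, x), (j, - y)]"
        using False ji y snoc.prems(2) by (auto simp: red_Cons F_uminus)
      let ?L = "G @ [(j, y), (i, x), (j, - y)] @ inv_syllables G"
      have "w = prd ?L"
        by (simp only: w_eq prd_append prd_Cons prd_Nil snd_conv prd_inv_syllables group_normalize)
      moreover have "red ?L" "fst (hd ?L) = fst (last ?L)"
        using red_conjugated[OF M _ _ _ Gy] by auto
      moreover have "2 \<le> length ?L" by simp
      ultimately show ?thesis by blast
    qed
  qed
qed

theorem cred_conj:
  assumes "cred S" "cred T" "syllables L" "prd T = - prd L + prd S + prd L"
  shows "\<exists>n k. prd (rotate n T) = e k + prd S + - e k"
proof -
  obtain G l where G: "red G" "prd L = prd G + e l"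
    using reduced_form[OF assms(3)] by blast
  have "prd S = prd L + prd T + - prd L"
    by (simp only: assms(4) group_normalize)
  then obtain n k where "prd S = e k + prd (rotate n T) + - e k"
    using cred_conj_aux[OF G(1) assms(2,1), of l] unfolding G(2) by blast
  then have "prd (rotate n T) = e (- k) + prd S + - e (- k)"
    by (simp only: group_normalize e_uminus)
  then show ?thesis by blast
qed

text \<open>A conjugate of \<open>x\<close> is either reduced with equal ends or an element of a
  factor, and a cyclically reduced product is neither.\<close>

theorem cred_not_short_conj:
  assumes "cred T" "x \<in> F i" "syllables L" "prd T = - prd L + x + prd L"
  shows False
proof -
  \<comment> \<open>\<open>short_conj_aux\<close> conjugates with the inverse on the right, so the
    reduced form is taken of the inverse conjugator.\<close>
  obtain G l where G: "red G" "prd (inv_syllables L) = prd G + e l"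
    using reduced_form[OF syllables_inv_syllables[OF assms(3)]] by blast
  then have "- prd L = prd G + e l" by (simp add: prd_inv_syllables)
  then have "prd T = (prd G + e l) + x + - (prd G + e l)"
    by (metis assms(4) minus_minus)
  from short_conj_aux[OF G(1) assms(2) this]
  show False
  proof (elim disjE exE conjE)
    fix M assume M: "red M" "2 \<le> length M" "fst (hd M) = fst (last M)" "prd T = prd M"
    then show False using cred_not_conjugated[OF assms(1) M(1) _ M(3,4)] by fastforce
  next
    fix j assume "prd T \<in> F j"
    show False
    proof (cases "prd T \<in> range e")
      case True
      then show False using red_not_e assms(1) by (auto simp: cred_def)
    next
      case False
      then have "red [(j, prd T)]" using \<open>prd T \<in> F j\<close> by (simp add: red_single)
      from cred_not_conjugated[OF assms(1) this] show False by simp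
    qed
  qed
qed

theorem short_conj:
  assumes "x \<in> F i" "y \<in> F j" "syllables L" "y = - prd L + x + prd L"
  shows "short_conj i x j y"
proof -
  obtain G l where G: "red G" "prd (inv_syllables L) = prd G + e l"
    using reduced_form[OF syllables_inv_syllables[OF assms(3)]] by blast
  then have "- prd L = prd G + e l" by (simp add: prd_inv_syllables)
  then have "y = (prd G + e l) + x + - (prd G + e l)"
    by (metis assms(4) minus_minus)
  from short_conj_aux[OF G(1) assms(1) this]
  show ?thesis
  proof (elim disjE exE conjE)
    fix M assume M: "red M" "2 \<le> length M" "y = prd M"
    \<comment> \<open>A reduced product of two or more syllables cannot lie in a factor:
      \<open>y\<close> would have a second factor sequence, of length one.\<close>
    have "y \<notin> range e" using red_not_e[of M] M by auto
    then have "red [(j, y)]" using assms(2) by (simp add: red_single)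
    then have "map fst M = [j]" using normal_form[of M "[(j, y)]" 0 0] M by simp
    then have "length M = 1" by (metis length_map length_Cons list.size(3) One_nat_def)
    then show ?thesis using M by simp
  next
    fix j' assume j': "y \<in> F j'" "short_conj i x j' y"
    show ?thesis
    proof (cases "j' = j")
      case False
      \<comment> \<open>Lying in both factors, \<open>y\<close> is a power, and it serves as the
        intermediate power itself.\<close>
      then obtain k where k: "y = e k" using mem_two[OF assms(2) j'(1)] by auto
      have "fconj i x (e m)" if "fconj i x (e m)" "fconj j' (e k) (e m)" for m
        using that fconj_e by blast
      then have "fconj i x (e k)"
        using j'(2) fconj_e unfolding short_conj_def k by fastforce
      then show ?thesis unfolding short_conj_def using k fconj_refl by blast
    qed (use j' in simp)
  qed
qed

text \<open>Reduces conjugation by a power to a double coset equation inside one factor: in T^(-1)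
  (e r S e(-r)) = 1 the adjoining first syllables must cancel into the subgroup, or a nonempty
  reduced product would be trivial.\<close>

theorem first_syllable:
  assumes "red S" "length S \<ge> 2" "red T" "prd T = e r + prd S + - e r"
  shows "T \<noteq> [] \<and> fst (hd S) = fst (hd T) \<and> (\<exists>s. e r + snd (hd S) + e s = snd (hd T))"
proof -
  obtain i p S' where S: "S = (i, p) # S'" using assms(2) by (cases S) auto
  with assms(2) obtain i' x S'' where S': "S' = S'' @ [(i', x)]"
    by (cases S' rule: rev_cases) auto
  have red_S: "p \<in> F i" "p \<notin> range e" "red S''" "x \<in> F i'" "x \<notin> range e"
    "S'' = [] \<or> fst (last S'') \<noteq> i'" "fst (hd S') \<noteq> i"
    using assms(1) by (auto simp: S S' red_Cons red_append red_single)
  \<comment> \<open>The right-hand power goes into the last syllable; as there are at least two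
    syllables, the first one is not touched by it.\<close>
  define V where "V = S'' @ [(i', x + e (- r))]"
  have V: "red V" "V \<noteq> []" "fst (hd V) \<noteq> i"
    using red_S by (auto simp: V_def S' red_append red_single F_add e_in hd_append)
  have iV: "red ((i, e r + p) # V)"
    using V red_S by (auto simp: red_Cons F_add e_in)
  have T_eq: "prd T = e r + p + prd V"
    by (simp only: assms(4) S S' V_def prd_append prd_Cons prd_Nil snd_conv group_normalize e_uminus)
  then have "map fst T = map fst ((i, e r + p) # V)"
    using normal_form[OF assms(3) iV, of 0 0] by simp
  then obtain q T' where T: "T = (i, q) # T'"
    by (cases T) auto
  have red_T: "q \<in> F i" "red T'" "T' = [] \<or> fst (hd T') \<noteq> i"
    using assms(3) by (auto simp: T red_Cons)
  have "- q + (e r + p) \<in> range e"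
  proof (rule ccontr)
    assume "- q + (e r + p) \<notin> range e"
    then have "red (inv_syllables T' @ (i, - q + (e r + p)) # V)"
      using red_T V red_S red_inv_syllables[OF red_T(2)]
      by (auto simp: red_append red_Cons F_add F_uminus e_in inv_syllables_def last_rev hd_map)
    moreover have "prd (inv_syllables T' @ (i, - q + (e r + p)) # V) = e 0"
    proof -
      have "q + prd T' = e r + p + prd V" using T_eq by (simp add: T)
      then have "prd V = - (e r + p) + (q + prd T')" by (metis minus_add_cancel)
      then show ?thesis
        by (simp only: prd_append prd_Cons snd_conv prd_inv_syllables group_normalize e_zero)
    qed
    ultimately show False using red_not_e by blast
  qed
  then obtain m where "- q + (e r + p) = e m" by auto
  then have "e r + p + e (- m) = q"
    by (metis add.assoc add_minus_cancel e_uminus minus_add_cancel right_minus add_0_right)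
  then show ?thesis by (auto simp: S T)
qed

end

section \<open>The amalgamated product given by a presentation\<close>

lemma word_perm_eq_iff_word_eq:
  assumes "wf_presentation P" "u \<in> words P" "v \<in> words P"
  shows "word_perm P u = word_perm P v \<longleftrightarrow> word_eq P u v"
  using word_perm_eq_iff[OF assms] elt_eq_iff[OF assms] by simp

lemma word_perm_power_word_cong:
  assumes "wf_presentation P" "word_perm P g = word_perm P h"
  shows "word_perm P (power_word g k) = word_perm P (power_word h k)"
proof -
  have cong: "word_perm P (concat (replicate n u)) = word_perm P (concat (replicate n v))"
    if "word_perm P u = word_perm P v" for n u v
    using that by (induction n) auto
  show ?thesis
    using cong[OF assms(2)] cong[of "inv_word g" "inv_word h"] assms
    by (simp add: power_word_def word_perm_inv_word)
qed

locale presented_amalgam =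
  fixes A B :: presentation and a b :: word
  assumes wf_A: "wf_presentation A" and wf_B: "wf_presentation B"
    and a_in: "a \<in> words A" and b_in: "b \<in> words B"
    and iso_cyclic: "\<exists>\<phi> \<in> iso (cyclic_subgroup A (elt A a)) (cyclic_subgroup B (elt B b)).
           \<phi> (elt A a) = elt B b"
    and nsc_A: "non_self_conjugate (pgroup A) (elt A a)"
    and nsc_B: "non_self_conjugate (pgroup B) (elt B b)"
begin

definition factor :: "bool \<Rightarrow> presentation" where "factor i = (if i then A else B)"
definition amalgamated :: "bool \<Rightarrow> word" where "amalgamated i = (if i then a else b)"
definition embed :: "bool \<Rightarrow> word \<Rightarrow> word" where
  "embed i = map (\<lambda>(x, s). (if i then 2 * x else 2 * x + 1, s))"

abbreviation "G \<equiv> amalgam A B a b"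

lemma wf_factor: "wf_presentation (factor i)"
  by (simp add: factor_def wf_A wf_B)

lemma amalgamated_in: "amalgamated i \<in> words (factor i)"
  by (simp add: factor_def amalgamated_def a_in b_in)

lemma wf_G: "wf_presentation G"
  by (rule wf_amalgam[OF wf_A wf_B a_in b_in])

lemma embed_True: "embed True = word_inl" and embed_False: "embed False = word_inr"
  by (simp_all add: embed_def word_inl_def word_inr_def fun_eq_iff)

lemma embed_append [simp]: "embed i (u @ v) = embed i u @ embed i v"
  and embed_Nil [simp]: "embed i [] = []"
  by (simp_all add: embed_def)

lemma embed_inv_word: "embed i (inv_word w) = inv_word (embed i w)"
  by (simp add: embed_def inv_word_def rev_map o_def split_def)

lemma embed_power_word: "embed i (power_word h k) = power_word (embed i h) k"
proof -
  have "embed i (concat (replicate n u)) = concat (replicate n (embed i u))" for n u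
    by (induction n) auto
  then show ?thesis by (simp add: power_word_def embed_inv_word)
qed

lemma embed_words: "w \<in> words (factor i) \<Longrightarrow> embed i w \<in> words G"
  by (auto simp: embed_def factor_def words_def amalgam_def in_lists_conv_set split: if_splits)

lemma letter_words_G:
  assumes "(n, s) # w \<in> words G"
  obtains "[(n div 2, s)] \<in> words (factor (even n))" "w \<in> words G"
    "[(n, s)] = embed (even n) [(n div 2, s)]"
  using assms that by (auto simp: words_def amalgam_def factor_def embed_def)

lemma relators_G:
  assumes "r \<in> rels G"
  obtains i r' where "r' \<in> rels (factor i)" "r = embed i r'"
    | "r = embed True (amalgamated True) @ embed False (inv_word (amalgamated False))"
  using assms that unfolding amalgam_def
  by (auto simp: embed_inv_word) (metis amalgamated_def embed_False embed_True factor_def)+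

lemma word_eq_embed:
  assumes "word_eq (factor i) u v"
  shows "word_eq G (embed i u) (embed i v)"
  using assms
proof induction
  case (refl u)
  then show ?case by (intro word_eq.refl embed_words)
next
  case (sym u v)
  show ?case by (rule word_eq.sym[OF sym.IH])
next
  case (trans u v w)
  then show ?case by (blast intro: word_eq.trans)
next
  case (cancel u v x s)
  have "(if i then 2 * x else 2 * x + 1) \<in> gens G"
    using cancel by (auto simp: amalgam_def factor_def)
  from word_eq.cancel[OF embed_words embed_words this] cancel show ?case
    by (simp add: embed_def)
next
  case (relator u v r)
  have "embed i r \<in> rels G"
    using relator by (auto simp: amalgam_def factor_def embed_True embed_False split: if_splits)
  from word_eq.relator[OF embed_words embed_words this] relator show ?case
    by simp
qed

section \<open>The factors as permutation groups and the agreement of their exponents\<close>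

definition fperm :: "bool \<Rightarrow> word \<Rightarrow> word set permutation" where
  "fperm i w = word_perm (factor i) w"

definition fexp :: "bool \<Rightarrow> int \<Rightarrow> word set permutation" where
  "fexp i k = fperm i (power_word (amalgamated i) k)"

text \<open>Here the given isomorphism enters: it carries the powers of \<open>a\<close> injectively
  to those of \<open>b\<close>, so exponents are identified in the same way on both sides.\<close>

lemma elt_pow_cyclic_eq_iff:
  fixes k m :: int
  shows "elt A a [^]\<^bsub>pgroup A\<^esub> k = elt A a [^]\<^bsub>pgroup A\<^esub> m \<longleftrightarrow>
    elt B b [^]\<^bsub>pgroup B\<^esub> k = elt B b [^]\<^bsub>pgroup B\<^esub> m"
proof -
  interpret A: group "pgroup A" using wf_A by (rule group_pgroup)
  interpret B: group "pgroup B" using wf_B by (rule group_pgroup)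
  obtain \<phi> where \<phi>: "\<phi> \<in> iso (cyclic_subgroup A (elt A a)) (cyclic_subgroup B (elt B b))"
    "\<phi> (elt A a) = elt B b" using iso_cyclic by blast
  have aA: "elt A a \<in> carrier (pgroup A)" "elt B b \<in> carrier (pgroup B)"
    using a_in b_in elt_closed by auto
  have sA: "subgroup (generate (pgroup A) {elt A a}) (pgroup A)"
    and sB: "subgroup (generate (pgroup B) {elt B b}) (pgroup B)"
    using aA A.generate_is_subgroup B.generate_is_subgroup by auto
  have gA: "group (cyclic_subgroup A (elt A a))" and gB: "group (cyclic_subgroup B (elt B b))"
    unfolding cyclic_subgroup_def using A.subgroup_imp_group[OF sA] B.subgroup_imp_group[OF sB] .
  have ga: "elt A a \<in> generate (pgroup A) {elt A a}" "elt B b \<in> generate (pgroup B) {elt B b}"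
    by (simp_all add: generate.incl)
  have powA: "elt A a [^]\<^bsub>pgroup A\<^esub> n = elt A a [^]\<^bsub>cyclic_subgroup A (elt A a)\<^esub> n"
    and powB: "elt B b [^]\<^bsub>pgroup B\<^esub> n = elt B b [^]\<^bsub>cyclic_subgroup B (elt B b)\<^esub> n" for n :: int
    unfolding cyclic_subgroup_def
    using A.int_pow_consistent[OF sA ga(1)] B.int_pow_consistent[OF sB ga(2)] .
  have ca: "elt A a \<in> carrier (cyclic_subgroup A (elt A a))"
    using ga by (simp add: cyclic_subgroup_def)
  have "\<phi> \<in> hom (cyclic_subgroup A (elt A a)) (cyclic_subgroup B (elt B b))"
    using \<phi>(1) by (simp add: iso_def)
  then interpret h: group_hom "cyclic_subgroup A (elt A a)" "cyclic_subgroup B (elt B b)" \<phi>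
    using gA gB by (simp add: group_hom_def group_hom_axioms_def)
  have hom: "\<phi> (elt A a [^]\<^bsub>pgroup A\<^esub> n) = elt B b [^]\<^bsub>pgroup B\<^esub> n" for n :: int
    using h.hom_int_pow[OF ca, of n] unfolding powA powB \<phi>(2) .
  have inj: "inj_on \<phi> (carrier (cyclic_subgroup A (elt A a)))"
    using \<phi>(1) by (simp add: iso_def bij_betw_def)
  have mem: "elt A a [^]\<^bsub>pgroup A\<^esub> n \<in> carrier (cyclic_subgroup A (elt A a))" for n :: int
    unfolding powA by (rule group.int_pow_closed[OF gA ca])
  have "\<phi> (elt A a [^]\<^bsub>pgroup A\<^esub> k) = \<phi> (elt A a [^]\<^bsub>pgroup A\<^esub> m) \<longleftrightarrow>
      elt A a [^]\<^bsub>pgroup A\<^esub> k = elt A a [^]\<^bsub>pgroup A\<^esub> m"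
    by (rule inj_on_eq_iff[OF inj mem mem])
  then show ?thesis unfolding hom by blast
qed

lemma fexp_eq_iff: "fexp i k = fexp i m \<longleftrightarrow>
    elt (factor i) (amalgamated i) [^]\<^bsub>pgroup (factor i)\<^esub> k =
    elt (factor i) (amalgamated i) [^]\<^bsub>pgroup (factor i)\<^esub> m"
  unfolding fexp_def fperm_def
  by (simp add: word_perm_eq_iff[OF wf_factor] power_word_words[OF amalgamated_in]
      elt_power_word[OF wf_factor amalgamated_in])

sublocale factors: amalgamated_factors "\<lambda>i. fperm i ` words (factor i)" fexp
proof
  fix i j k m
  show "fexp i k \<in> fperm i ` words (factor i)"
    unfolding fexp_def by (intro imageI power_word_words amalgamated_in)
  show "fexp i (k + m) = fexp i k + fexp i m"
    unfolding fexp_def fperm_def by (rule word_perm_power_word_add[OF wf_factor amalgamated_in])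
  have "fexp True k = fexp True m \<longleftrightarrow> fexp False k = fexp False m"
    using elt_pow_cyclic_eq_iff[of k m] by (simp add: fexp_eq_iff) (simp add: factor_def amalgamated_def)
  then show "fexp i k = fexp i m \<longleftrightarrow> fexp j k = fexp j m"
    by (cases i; cases j) auto
next
  fix x y i assume "x \<in> fperm i ` words (factor i)" "y \<in> fperm i ` words (factor i)"
  then obtain u v where "u \<in> words (factor i)" "v \<in> words (factor i)" "x = fperm i u" "y = fperm i v"
    by blast
  then show "x + y \<in> fperm i ` words (factor i)"
    by (intro image_eqI[of _ _ "u @ v"]) (simp_all add: fperm_def)
next
  fix x i assume "x \<in> fperm i ` words (factor i)"
  then obtain u where "u \<in> words (factor i)" "x = fperm i u" by blast
  then show "- x \<in> fperm i ` words (factor i)"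
    by (intro image_eqI[of _ _ "inv_word u"])
      (simp_all add: fperm_def word_perm_inv_word[OF wf_factor] inv_word_words)
qed

text \<open>Letter 2x is generator x of \<open>A\<close> and letter 2x+1 is generator x of
  \<open>B\<close>, so parity selects the acting factor and halving recovers the generator.\<close>

definition word_act :: "word \<Rightarrow> int \<times> (bool \<times> word set permutation) list \<Rightarrow>
    int \<times> (bool \<times> word set permutation) list" where
  "word_act w x = foldr (\<lambda>(n, s). factors.act (even n) (fperm (even n) [(n div 2, s)])) w x"

lemma word_act_append [simp]: "word_act (u @ v) x = word_act u (word_act v x)"
  and word_act_Nil [simp]: "word_act [] x = x"
  by (simp_all add: word_act_def)

lemma normal_word_act:
  assumes "w \<in> words G" "factors.normal x"
  shows "factors.normal (word_act w x)"
  using assms(1)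
proof (induction w)
  case (Cons l w)
  obtain n s where l: "l = (n, s)" by (cases l)
  have "[(n div 2, s)] \<in> words (factor (even n))" "w \<in> words G"
    using Cons.prems unfolding l by (elim letter_words_G; simp)+
  then show ?case
    using factors.normal_act[OF imageI] Cons.IH by (simp add: word_act_def l)
qed (simp add: assms)

lemma word_act_embed:
  assumes "w \<in> words (factor i)" "factors.normal x"
  shows "word_act (embed i w) x = factors.act i (fperm i w) x"
  using assms(1)
proof (induction w)
  case Nil
  then show ?case using factors.act_0[OF assms(2)] by (simp add: fperm_def)
next
  case (Cons l w)
  obtain n s where l: "l = (n, s)" by (cases l)
  have w: "w \<in> words (factor i)" using Cons.prems words_append_iff[of "[l]" w] by simp
  have "fperm i (l # w) = fperm i [l] + fperm i w"
    using word_perm_append[of "factor i" "[l]" w] by (simp add: fperm_def)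
  moreover have "word_act (embed i (l # w)) x = factors.act i (fperm i [l]) (word_act (embed i w) x)"
    by (simp add: word_act_def embed_def l)
  ultimately show ?case by (simp add: Cons.IH[OF w] factors.act_add[OF assms(2)])
qed

lemma word_act_relator:
  assumes "r \<in> rels G" "factors.normal x"
  shows "word_act r x = x"
  using assms(1)
proof (cases rule: relators_G)
  case (1 i r')
  then have r': "r' \<in> words (factor i)"
    using wf_factor unfolding wf_presentation_def by blast
  have "word_eq (factor i) r' []"
    using word_eq.relator[of "[]" "factor i" "[]" r'] 1 by simp
  then have "fperm i r' = 0"
    using word_perm_eq_iff_word_eq[OF wf_factor r', of "[]"] by (simp add: fperm_def)
  then show ?thesis
    using word_act_embed[OF r' assms(2)] factors.act_0[OF assms(2)] 1 by simp
next
  case 2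
  have "fperm i (amalgamated i) = fexp i 1" for i
    by (simp add: fexp_def power_word_def)
  moreover have "fperm i (inv_word (amalgamated i)) = fexp i (- 1)" for i
    by (simp add: fexp_def power_word_def)
  moreover have "factors.normal (word_act (embed False (inv_word (amalgamated False))) x)"
    by (intro normal_word_act embed_words inv_word_words amalgamated_in assms(2))
  ultimately have "word_act r x = factors.act True (fexp True 1) (factors.act False (fexp False (- 1)) x)"
    by (simp add: 2 word_act_embed assms(2) amalgamated_in inv_word_words)
  \<comment> \<open>By \<open>act_e\<close> the power contributed by \<open>b\<close> may be read as
    a power of \<open>a\<close>, where it cancels.\<close>
  also have "\<dots> = factors.act True (fexp True 1) (factors.act True (fexp True (- 1)) x)"
    by (simp add: factors.act_e assms(2))
  also have "\<dots> = x"
    using factors.act_add[OF assms(2), of True "fexp True 1" "fexp True (- 1)"]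
      factors.e_add[of True 1 "- 1"] factors.act_0[OF assms(2)] by (simp add: factors.e_zero)
  finally show ?thesis .
qed

text \<open>The actions of the two factors fit together into one of the amalgamated product on
  normal forms.\<close>

lemma word_act_cong:
  assumes "word_eq G u v" "factors.normal x"
  shows "word_act u x = word_act v x"
  using assms
proof (induction arbitrary: x)
  case (cancel u v n s)
  let ?y = "word_act v x"
  have y: "factors.normal ?y" using cancel normal_word_act by blast
  have "[(n, s), (n, \<not> s)] \<in> words G" using cancel by (simp add: words_def)
  then have w: "[(n div 2, s), (n div 2, \<not> s)] \<in> words (factor (even n))"
    and eq: "[(n, s), (n, \<not> s)] = embed (even n) [(n div 2, s), (n div 2, \<not> s)]"
    by (auto simp: words_def amalgam_def factor_def embed_def)
  have "word_eq (factor (even n)) [(n div 2, s), (n div 2, \<not> s)] []"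
    using word_eq.cancel[of "[]" "factor (even n)" "[]" "n div 2" s] w by (simp add: words_def)
  then have "fperm (even n) [(n div 2, s), (n div 2, \<not> s)] = 0"
    using word_perm_eq_iff_word_eq[OF wf_factor w, of "[]"] by (simp add: fperm_def)
  then have "word_act [(n, s), (n, \<not> s)] ?y = ?y"
    using word_act_embed[OF w y] factors.act_0[OF y] eq by simp
  moreover have "u @ [(n, s), (n, \<not> s)] @ v = u @ ([(n, s), (n, \<not> s)] @ v)" by simp
  ultimately show ?case by (simp only: word_act_append)
next
  case (relator u v r)
  then show ?case using word_act_relator normal_word_act by simp
qed simp_all

abbreviation gperm :: "word \<Rightarrow> word set permutation" where
  "gperm \<equiv> word_perm G"

lemma gperm_eq_word_act:
  assumes "gperm u = gperm v" "u \<in> words G" "v \<in> words G" "factors.normal x"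
  shows "word_act u x = word_act v x"
  using assms word_act_cong word_perm_eq_iff_word_eq[OF wf_G] by blast

text \<open>The factors embed: equal elements of \<open>G\<close> act equally on the normal form of
  the identity, and each factor acts freely.\<close>

lemma gperm_embed_eq_iff:
  assumes "u \<in> words (factor i)" "v \<in> words (factor i)"
  shows "gperm (embed i u) = gperm (embed i v) \<longleftrightarrow> fperm i u = fperm i v"
proof
  assume "gperm (embed i u) = gperm (embed i v)"
  from gperm_eq_word_act[OF this embed_words embed_words factors.normal_canon]
  have "factors.act i (fperm i u) (factors.canon 0, []) = factors.act i (fperm i v) (factors.canon 0, [])"
    using assms by (simp add: word_act_embed factors.normal_canon)
  then show "fperm i u = fperm i v"
    by (rule factors.act_inj[OF factors.normal_canon])
next
  assume "fperm i u = fperm i v"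
  then show "gperm (embed i u) = gperm (embed i v)"
    using assms word_eq_embed
    by (simp add: fperm_def word_perm_eq_iff_word_eq wf_factor wf_G embed_words)
qed

section \<open>The factors and the common cyclic subgroup inside the amalgamated product\<close>

definition gfactor :: "bool \<Rightarrow> word set permutation set" where
  "gfactor i = gperm ` embed i ` words (factor i)"

definition gexp :: "int \<Rightarrow> word set permutation" where
  "gexp k = gperm (power_word (embed True (amalgamated True)) k)"

lemma gfactorI: "w \<in> words (factor i) \<Longrightarrow> gperm (embed i w) \<in> gfactor i"
  by (simp add: gfactor_def)

lemma gexp_eq: "gexp k = gperm (embed i (power_word (amalgamated i) k))"
proof -
  let ?u = "embed True (amalgamated True)" and ?v = "embed False (amalgamated False)"
  have uv: "?u \<in> words G" "?v \<in> words G" by (rule embed_words[OF amalgamated_in])+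
  have "?u @ inv_word ?v \<in> rels G"
    by (simp add: amalgam_def embed_True embed_False amalgamated_def)
  then have "word_eq G (?u @ inv_word ?v) []"
    using word_eq.relator[of "[]" G "[]"] by simp
  then have "gperm (?u @ inv_word ?v) = 0"
    using word_perm_eq_iff_word_eq[OF wf_G, of "?u @ inv_word ?v" "[]"] uv by (simp add: inv_word_words)
  then have "gperm ?u = gperm ?v"
    by (simp add: word_perm_inv_word[OF wf_G])
  then have "gperm (power_word ?u k) = gperm (power_word ?v k)"
    by (rule word_perm_power_word_cong[OF wf_G])
  then show ?thesis by (cases i) (simp_all add: gexp_def embed_power_word)
qed

lemma gexp_eq_iff: "gexp k = gexp m \<longleftrightarrow> fexp i k = fexp i m"
  unfolding gexp_eq[of _ i] fexp_def
  by (rule gperm_embed_eq_iff) (rule power_word_words[OF amalgamated_in])+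

lemma conjugate_factor_iff:
  assumes "u \<in> words (factor i)" "v \<in> words (factor i)"
  shows "conjugate (pgroup (factor i)) (elt (factor i) u) (elt (factor i) v) \<longleftrightarrow>
    (\<exists>g\<in>gfactor i. gperm (embed i v) = - g + gperm (embed i u) + g)"
proof -
  have "gperm (embed i v) = - gperm (embed i g) + gperm (embed i u) + gperm (embed i g) \<longleftrightarrow>
      fperm i v = - fperm i g + fperm i u + fperm i g" if "g \<in> words (factor i)" for g
    using gperm_embed_eq_iff[of v i "inv_word g @ u @ g"] assms that
    by (simp add: inv_word_words embed_inv_word word_perm_inv_word wf_G wf_factor fperm_def add.assoc)
  then show ?thesis
    using conjugate_word_perm_iff[OF wf_factor assms] by (auto simp: gfactor_def fperm_def)
qed

lemma gexp_conj:
  assumes "g \<in> gfactor i" "gexp m = - g + gexp k + g"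
  shows "gexp k = gexp m"
proof (rule ccontr)
  assume neq: "gexp k \<noteq> gexp m"
  let ?c = "\<lambda>k. power_word (amalgamated i) k"
  have "conjugate (pgroup (factor i)) (elt (factor i) (?c k)) (elt (factor i) (?c m))"
    using assms unfolding gexp_eq[of _ i]
    by (subst conjugate_factor_iff) (auto simp: power_word_words[OF amalgamated_in])
  moreover have "non_self_conjugate (pgroup (factor i)) (elt (factor i) (amalgamated i))"
    using nsc_A nsc_B by (simp add: factor_def amalgamated_def)
  ultimately show False
    using neq unfolding gexp_eq_iff[of _ _ i] fexp_eq_iff
    by (simp add: non_self_conjugate_def elt_power_word[OF wf_factor amalgamated_in])
qed

text \<open>Reduced products live in \<open>G\<close> but the action is that of factor elements;
  spelling the syllables by words links the two, and the embedding keeps them outside the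
  subgroup.\<close>

lemma reduced_words:
  assumes "reduced gfactor (\<lambda>_. gexp) S"
  obtains W where "\<forall>(i, w) \<in> set W. w \<in> words (factor i)"
    "S = map (\<lambda>(i, w). (i, gperm (embed i w))) W"
    "reduced (\<lambda>i. fperm i ` words (factor i)) fexp (map (\<lambda>(i, w). (i, fperm i w)) W)"
proof -
  have "\<forall>p. \<exists>w. p \<in> set S \<longrightarrow> w \<in> words (factor (fst p)) \<and> snd p = gperm (embed (fst p) w)"
    using assms by (fastforce simp: reduced_def gfactor_def)
  then obtain c where c: "\<And>p. p \<in> set S \<Longrightarrow>
      c p \<in> words (factor (fst p)) \<and> snd p = gperm (embed (fst p) (c p))"
    by metis
  define W where "W = map (\<lambda>p. (fst p, c p)) S"
  have W: "\<forall>(i, w) \<in> set W. w \<in> words (factor i)" using c by (auto simp: W_def)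
  moreover have S: "S = map (\<lambda>(i, w). (i, gperm (embed i w))) W"
    unfolding W_def using c by (auto simp: prod_eq_iff intro!: map_idI[symmetric])
  moreover have "reduced (\<lambda>i. fperm i ` words (factor i)) fexp (map (\<lambda>(i, w). (i, fperm i w)) W)"
  proof -
    have "alternating (map (\<lambda>(i, w). (i, fperm i w)) W) = alternating S"
      by (rule alternating_map_fst) (simp add: S split_def o_def)
    moreover have "fperm i w \<notin> range (fexp i)" if iw: "(i, w) \<in> set W" for i w
    proof
      assume "fperm i w \<in> range (fexp i)"
      then obtain k where "fperm i w = fexp i k" by auto
      then have "gperm (embed i w) = gexp k"
        unfolding gexp_eq[of k i] fexp_def using iw W
        by (subst gperm_embed_eq_iff) (auto simp: power_word_words[OF amalgamated_in])
      moreover have "(i, gperm (embed i w)) \<in> set S" using iw by (force simp: S)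
      ultimately show False using assms by (auto simp: reduced_def)
    qed
    ultimately show ?thesis
      using assms W by (auto simp: reduced_def)
  qed
  ultimately show ?thesis using that by blast
qed

lemma syllable_words_concat:
  assumes "\<forall>(i, w) \<in> set W. w \<in> words (factor i)"
  shows "concat (map (\<lambda>(i, w). embed i w) W) \<in> words G"
    and "prd (map (\<lambda>(i, w). (i, gperm (embed i w))) W) = gperm (concat (map (\<lambda>(i, w). embed i w) W))"
    and "factors.normal x \<Longrightarrow> word_act (concat (map (\<lambda>(i, w). embed i w) W)) x =
      foldr (\<lambda>(i, g). factors.act i g) (map (\<lambda>(i, w). (i, fperm i w)) W) x"
proof -
  let ?c = "\<lambda>W. concat (map (\<lambda>(i, w). embed i w) W)"
  have "?c W \<in> words G \<and> prd (map (\<lambda>(i, w). (i, gperm (embed i w))) W) = gperm (?c W) \<and>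
      (\<forall>x. factors.normal x \<longrightarrow> word_act (?c W) x =
        foldr (\<lambda>(i, g). factors.act i g) (map (\<lambda>(i, w). (i, fperm i w)) W) x)"
    using assms
  proof (induction W)
    case (Cons p W)
    obtain i w where p: "p = (i, w)" by (cases p)
    have w: "w \<in> words (factor i)" using Cons.prems by (simp add: p)
    have IH: "?c W \<in> words G" "prd (map (\<lambda>(i, w). (i, gperm (embed i w))) W) = gperm (?c W)"
      "\<And>x. factors.normal x \<Longrightarrow> word_act (?c W) x =
        foldr (\<lambda>(i, g). factors.act i g) (map (\<lambda>(i, w). (i, fperm i w)) W) x"
      using Cons by auto
    have "word_act (?c (p # W)) x =
        foldr (\<lambda>(i, g). factors.act i g) (map (\<lambda>(i, w). (i, fperm i w)) (p # W)) x"
      if x: "factors.normal x" for x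
      using word_act_embed[OF w normal_word_act[OF IH(1) x]] IH(3)[OF x] by (simp add: p)
    then show ?case using IH(1,2) embed_words[OF w] by (simp add: p)
  qed simp
  then show "?c W \<in> words G"
    and "prd (map (\<lambda>(i, w). (i, gperm (embed i w))) W) = gperm (?c W)"
    and "factors.normal x \<Longrightarrow> word_act (?c W) x =
      foldr (\<lambda>(i, g). factors.act i g) (map (\<lambda>(i, w). (i, fperm i w)) W) x"
    by blast+
qed

sublocale amalgamated_group gfactor gexp
proof
  fix i x y assume "x \<in> gfactor i" "y \<in> gfactor i"
  then obtain u v where "u \<in> words (factor i)" "v \<in> words (factor i)"
    "x = gperm (embed i u)" "y = gperm (embed i v)"
    unfolding gfactor_def by blast
  then show "x + y \<in> gfactor i"
    using gfactorI[of "u @ v" i] by simp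
next
  fix i x assume "x \<in> gfactor i"
  then obtain u where "u \<in> words (factor i)" "x = gperm (embed i u)"
    unfolding gfactor_def by blast
  then show "- x \<in> gfactor i"
    using gfactorI[of "inv_word u" i] by (simp add: inv_word_words embed_inv_word word_perm_inv_word[OF wf_G])
next
  fix i k show "gexp k \<in> gfactor i"
    unfolding gexp_eq[of k i] by (rule gfactorI[OF power_word_words[OF amalgamated_in]])
next
  fix k m show "gexp (k + m) = gexp k + gexp m"
    unfolding gexp_def by (rule word_perm_power_word_add[OF wf_G embed_words[OF amalgamated_in]])
next
  fix g i m k assume "g \<in> gfactor i" "gexp m = - g + gexp k + g"
  then show "gexp k = gexp m" by (rule gexp_conj)
next
  fix S T k m
  assume S: "reduced gfactor (\<lambda>_. gexp) S" and T: "reduced gfactor (\<lambda>_. gexp) T"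
    and eq: "gexp k + prd S = gexp m + prd T"
  let ?c = "\<lambda>k. embed True (power_word (amalgamated True) k)"
  let ?x = "(factors.canon 0, []) :: int \<times> (bool \<times> word set permutation) list"
  \<comment> \<open>Applied to the normal form of the identity, a word for e^k S displays the factor
    sequence of \<open>S\<close>; the leading power alters only the exponent.\<close>
  have key: "\<exists>w. w \<in> words G \<and> prd S = gperm w \<and>
      map fst (snd (word_act (?c k @ w) ?x)) = map fst S"
    if S: "reduced gfactor (\<lambda>_. gexp) S" for S k
  proof -
    obtain W where W: "\<forall>(i, w) \<in> set W. w \<in> words (factor i)"
      "S = map (\<lambda>(i, w). (i, gperm (embed i w))) W"
      "reduced (\<lambda>i. fperm i ` words (factor i)) fexp (map (\<lambda>(i, w). (i, fperm i w)) W)"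
      by (rule reduced_words[OF S])
    note nf = factors.act_reduced[OF W(3), of 0]
    let ?w = "concat (map (\<lambda>(i, w). embed i w) W)"
    note w = syllable_words_concat[OF W(1)]
    have "word_act (?c k) (word_act ?w ?x) = factors.act True (fexp True k) (word_act ?w ?x)"
      using nf(1) w(3)[OF factors.normal_canon]
      by (simp add: word_act_embed power_word_words[OF amalgamated_in] fexp_def)
    then have "map fst (snd (word_act (?c k @ ?w) ?x)) = map fst S"
      using nf w(3)[OF factors.normal_canon] W(2)
      by (simp add: factors.act_e o_def split_def)
    then show ?thesis using w(1,2) W(2) by blast
  qed
  obtain u where u: "u \<in> words G" "prd S = gperm u" "map fst (snd (word_act (?c k @ u) ?x)) = map fst S"
    using key[OF S] by blast
  obtain v where v: "v \<in> words G" "prd T = gperm v" "map fst (snd (word_act (?c m @ v) ?x)) = map fst T"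
    using key[OF T] by blast
  have c: "?c n \<in> words G" for n
    by (rule embed_words[OF power_word_words[OF amalgamated_in]])
  have "gperm (?c k @ u) = gperm (?c m @ v)"
    using eq by (simp add: u v gexp_eq[of _ True])
  from gperm_eq_word_act[OF this _ _ factors.normal_canon] have
    "word_act (?c k @ u) ?x = word_act (?c m @ v) ?x"
    using c u v by simp
  then show "map fst S = map fst T" using u v by simp
qed

lemma words_G_syllables:
  assumes "w \<in> words G"
  shows "\<exists>L. syllables L \<and> gperm w = prd L"
  using assms
proof (induction w)
  case Nil
  show ?case by (rule exI[of _ "[]"]) (simp add: syllables_def)
next
  case (Cons l w)
  obtain n s where l: "l = (n, s)" by (cases l)
  have ln: "[(n div 2, s)] \<in> words (factor (even n))" "[(n, s)] = embed (even n) [(n div 2, s)]"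
    and w: "w \<in> words G"
    using Cons.prems unfolding l by (elim letter_words_G; simp)+
  obtain L where "syllables L" "gperm w = prd L" using Cons.IH[OF w] by blast
  moreover have "gperm (l # w) = gperm (embed (even n) [(n div 2, s)]) + gperm w"
    using word_perm_append[of G "[l]" w] unfolding ln(2)[symmetric] l by simp
  ultimately show ?case
    using gfactorI[OF ln(1)]
    by (intro exI[of _ "(even n, gperm (embed (even n) [(n div 2, s)])) # L"]) (simp add: syllables_def)
qed

lemma fconj_iff:
  assumes "u \<in> words (factor i)" "v \<in> words (factor i)"
  shows "fconj i (gperm (embed i u)) (gperm (embed i v)) \<longleftrightarrow>
    conjugate (pgroup (factor i)) (elt (factor i) u) (elt (factor i) v)"
  by (simp add: conjugate_factor_iff[OF assms] fconj_def)

end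

section \<open>Deciding conjugacy\<close>

text \<open>Lets a list serve as the counter of a bounded iteration.\<close>

lemma foldl_ignore: "foldl (\<lambda>s _. f s) s xs = (f ^^ length xs) s"
  by (induction xs arbitrary: s) (simp_all add: funpow_swap1)

text \<open>The oracles, specified by elements of \<open>G\<close> and guaranteed only on words of
  the factor. \<open>coset_nonempty\<close> serves membership in the subgroup,
  \<open>coset_complete\<close> the comparison of first syllables.\<close>

locale amalgam_search = presented_amalgam +
  fixes cj :: "bool \<Rightarrow> word \<Rightarrow> word \<Rightarrow> bool"
    and powers :: "bool \<Rightarrow> word \<Rightarrow> int list"
    and coset :: "bool \<Rightarrow> word \<Rightarrow> word \<Rightarrow> (int \<times> int) list"
  assumes cj: "u \<in> words (factor i) \<Longrightarrow> v \<in> words (factor i) \<Longrightarrow>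
      cj i u v \<longleftrightarrow> fconj i (gperm (embed i u)) (gperm (embed i v))"
    and powers_sound: "u \<in> words (factor i) \<Longrightarrow> k \<in> set (powers i u) \<Longrightarrow>
      fconj i (gperm (embed i u)) (gexp k)"
    and powers_complete: "u \<in> words (factor i) \<Longrightarrow> fconj i (gperm (embed i u)) (gexp k) \<Longrightarrow>
      \<exists>k' \<in> set (powers i u). gexp k' = gexp k"
    and coset_sound: "u \<in> words (factor i) \<Longrightarrow> v \<in> words (factor i) \<Longrightarrow>
      (r, s) \<in> set (coset i u v) \<Longrightarrow> gexp r + gperm (embed i u) + gexp s = gperm (embed i v)"
    and coset_nonempty: "u \<in> words (factor i) \<Longrightarrow> v \<in> words (factor i) \<Longrightarrow>
      gexp r + gperm (embed i u) + gexp s = gperm (embed i v) \<Longrightarrow> coset i u v \<noteq> []"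
    and coset_complete: "u \<in> words (factor i) \<Longrightarrow> v \<in> words (factor i) \<Longrightarrow>
      gperm (embed i u) \<notin> range gexp \<Longrightarrow>
      gexp r + gperm (embed i u) + gexp s = gperm (embed i v) \<Longrightarrow>
      \<exists>p \<in> set (coset i u v). gexp (fst p) = gexp r"
begin

subsection \<open>Cyclic reduction\<close>

text \<open>A solution of h^r 1 h^s = w exhibits \<open>w\<close> as a power, which is then
  respelled in the other factor. The list of length at most one acts as an option.\<close>

definition transfer_word :: "bool \<Rightarrow> word \<Rightarrow> word list" where
  "transfer_word i w = (case coset i [] w of [] \<Rightarrow> [] | p # _ \<Rightarrow>
     [power_word (amalgamated (\<not> i)) (fst p) @ power_word (amalgamated (\<not> i)) (snd p)])"

text \<open>If nothing shortens at the front, the list is rotated, so the same local test eventually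
  reaches every syllable and also the junction of the two ends.\<close>

definition step :: "(bool \<times> word) list \<Rightarrow> (bool \<times> word) list" where
  "step S = (case S of [] \<Rightarrow> [] | x # T \<Rightarrow> (case T of [] \<Rightarrow> [x] | y # R \<Rightarrow>
     if fst x = fst y then (fst x, snd x @ snd y) # R
     else (case transfer_word (fst x) (snd x) of [] \<Rightarrow> y # R @ [x]
       | w # _ \<Rightarrow> (fst y, w @ snd y) # R)))"

text \<open>As many rounds as the input has syllables, each of as many steps; the lists inside the
  folds are mere counters.\<close>

definition reduce :: "(bool \<times> word) list \<Rightarrow> (bool \<times> word) list" where
  "reduce S = foldl (\<lambda>S' _. foldl (\<lambda>S'' _. step S'') S' S) S S"

definition word_syllables :: "word \<Rightarrow> (bool \<times> word) list" where
  "word_syllables w = map (\<lambda>l. (even (fst l), [(fst l div 2, snd l)])) w"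

definition valid :: "(bool \<times> word) list \<Rightarrow> bool" where
  "valid S \<longleftrightarrow> (\<forall>x \<in> set S. snd x \<in> words (factor (fst x)))"

definition sval :: "bool \<times> word \<Rightarrow> word set permutation" where
  "sval x = gperm (embed (fst x) (snd x))"

section \<open>Values of syllable lists and conjugacy between them\<close>

definition vals :: "(bool \<times> word) list \<Rightarrow> (bool \<times> word set permutation) list" where
  "vals S = map (\<lambda>x. (fst x, sval x)) S"

lemma vals_Nil [simp]: "vals [] = []"
  and vals_Cons [simp]: "vals (x # S) = (fst x, sval x) # vals S"
  and vals_append [simp]: "vals (S @ T) = vals S @ vals T"
  and vals_eq_Nil_iff [simp]: "vals S = [] \<longleftrightarrow> S = []"
  and length_vals [simp]: "length (vals S) = length S"
  by (simp_all add: vals_def)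

lemma valid_Nil [simp]: "valid []"
  and valid_Cons [simp]: "valid (x # S) \<longleftrightarrow> snd x \<in> words (factor (fst x)) \<and> valid S"
  and valid_append [simp]: "valid (S @ T) \<longleftrightarrow> valid S \<and> valid T"
  by (auto simp: valid_def)

lemma sval_in: "snd x \<in> words (factor (fst x)) \<Longrightarrow> sval x \<in> gfactor (fst x)"
  by (simp add: sval_def gfactorI)

lemma syllables_vals: "valid S \<Longrightarrow> syllables (vals S)"
  by (auto simp: syllables_def vals_def valid_def sval_in)

definition gconj :: "word set permutation \<Rightarrow> word set permutation \<Rightarrow> bool" where
  "gconj x y \<longleftrightarrow> (\<exists>L. syllables L \<and> y = - prd L + x + prd L)"

lemma gconj_refl: "gconj x x"
  unfolding gconj_def by (rule exI[of _ "[]"]) (simp add: syllables_def)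

lemma gconj_sym:
  assumes "gconj x y"
  shows "gconj y x"
proof -
  obtain L where L: "syllables L" "y = - prd L + x + prd L" using assms by (auto simp: gconj_def)
  have "x = - prd (inv_syllables L) + y + prd (inv_syllables L)"
    by (simp only: L(2) prd_inv_syllables group_normalize)
  then show ?thesis unfolding gconj_def using syllables_inv_syllables[OF L(1)] by blast
qed

lemma gconj_trans:
  assumes "gconj x y" "gconj y z"
  shows "gconj x z"
proof -
  obtain L M where L: "syllables L" "y = - prd L + x + prd L" and M: "syllables M" "z = - prd M + y + prd M"
    using assms by (auto simp: gconj_def)
  have "z = - prd (L @ M) + x + prd (L @ M)"
    by (simp only: L(2) M(2) prd_append group_normalize)
  moreover have "syllables (L @ M)" using L M by (auto simp: syllables_def)
  ultimately show ?thesis unfolding gconj_def by blast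
qed

lemma gconj_fconj: "fconj i x y \<Longrightarrow> gconj x y"
  unfolding fconj_def gconj_def
  by (elim bexE, rule_tac x = "[(i, g)]" in exI) (simp add: syllables_def)

lemma gconj_zero_iff: "gconj x 0 \<longleftrightarrow> x = 0"
proof
  assume "gconj x 0"
  from gconj_sym[OF this] obtain L where "x = - prd L + 0 + prd L" by (auto simp: gconj_def)
  then show "x = 0" by simp
qed (simp add: gconj_refl)

lemma gconj_rotate1:
  assumes "valid S"
  shows "gconj (prd (vals S)) (prd (vals (rotate1 S)))"
proof (cases S)
  case (Cons x T)
  have "prd (vals (rotate1 S)) = - prd (vals [x]) + prd (vals S) + prd (vals [x])"
    by (simp add: Cons add.assoc)
  moreover have "syllables (vals [x])" using assms Cons syllables_vals[of "[x]"] by simp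
  ultimately show ?thesis unfolding gconj_def by blast
qed (simp add: gconj_refl)

lemma gconj_rotate:
  assumes "valid S"
  shows "valid (rotate n S) \<and> gconj (prd (vals S)) (prd (vals (rotate n S)))"
proof (induction n)
  case (Suc n)
  then show ?case using gconj_rotate1[of "rotate n S"] gconj_trans by (auto simp: valid_def)
qed (simp add: assms gconj_refl)

lemma transfer_word_Nil:
  assumes "w \<in> words (factor i)" "transfer_word i w = []"
  shows "gperm (embed i w) \<notin> range gexp"
proof
  assume "gperm (embed i w) \<in> range gexp"
  then obtain k where "gperm (embed i w) = gexp k" by auto
  then have "gexp k + gperm (embed i []) + gexp 0 = gperm (embed i w)" by simp
  from coset_nonempty[OF _ assms(1) this] assms(2) show False
    by (simp add: transfer_word_def split: list.splits)
qed

lemma transfer_word_Cons: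
  assumes "w \<in> words (factor i)" "transfer_word i w = v # vs"
  shows "v \<in> words (factor (\<not> i))" "gperm (embed (\<not> i) v) = gperm (embed i w)"
    "gperm (embed i w) \<in> range gexp"
proof -
  obtain r s ps where c: "coset i [] w = (r, s) # ps"
    and v: "v = power_word (amalgamated (\<not> i)) r @ power_word (amalgamated (\<not> i)) s"
    using assms(2) by (auto simp: transfer_word_def split: list.splits)
  show "v \<in> words (factor (\<not> i))"
    by (simp add: v power_word_words[OF amalgamated_in])
  have "gexp r + gperm (embed i []) + gexp s = gperm (embed i w)"
    using coset_sound[OF _ assms(1), of "[]" r s] c by simp
  then have *: "gperm (embed i w) = gexp r + gexp s" by simp
  then show "gperm (embed (\<not> i) v) = gperm (embed i w)"
    by (simp add: v gexp_eq[of _ "\<not> i"])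
  show "gperm (embed i w) \<in> range gexp" unfolding * e_add[symmetric] by simp
qed

text \<open>The shortening case records that the list was not yet cyclically reduced, so that a
  cyclically reduced list is only rotated from then on.\<close>

lemma step_cases:
  assumes "valid S"
  obtains "length S \<le> 1" "step S = S"
  | "length (step S) < length S" "valid (step S)" "prd (vals (step S)) = prd (vals S)"
      "\<not> cred (vals S)"
  | x y R where "S = x # y # R" "fst x \<noteq> fst y" "sval x \<notin> range gexp" "step S = rotate1 S"
proof (cases S)
  case Nil
  then show ?thesis using that(1) by (simp add: step_def)
next
  case S: (Cons x T)
  show ?thesis
  proof (cases T)
    case Nil
    then show ?thesis using that(1) S by (simp add: step_def)
  next
    case T: (Cons y R)
    have xy: "snd x \<in> words (factor (fst x))" "snd y \<in> words (factor (fst y))" "valid R"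
      using assms by (auto simp: S T)
    show ?thesis
    proof (cases "fst x = fst y")
      case True
      then have step: "step (x # y # R) = (fst x, snd x @ snd y) # R" by (simp add: step_def)
      have "\<not> cred (vals S)" using True by (simp add: S T cred_def reduced_def)
      then show ?thesis
        using True xy by (intro that(2)) (simp_all add: step S T sval_def add.assoc)
    next
      case neq: False
      then have nfst: "fst y = (\<not> fst x)" by auto
      show ?thesis
      proof (cases "transfer_word (fst x) (snd x)")
        case Nil
        show ?thesis
        proof (rule that(3)[OF _ neq])
          show "S = x # y # R" by (simp add: S T)
          show "sval x \<notin> range gexp" unfolding sval_def by (rule transfer_word_Nil[OF xy(1) Nil])
          show "step S = rotate1 S" using neq Nil by (simp add: step_def S T)
        qed
      next
        case (Cons w ws)
        note tw = transfer_word_Cons[OF xy(1) Cons, folded nfst]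
        have step: "step (x # y # R) = (fst y, w @ snd y) # R"
          using neq Cons by (simp add: step_def)
        have "sval x \<in> range gexp" using tw(3) by (simp add: sval_def)
        then have "\<not> cred (vals S)" by (simp add: S T cred_def reduced_def)
        then show ?thesis
          using tw xy by (intro that(2)) (simp_all add: step S T sval_def add.assoc)
      qed
    qed
  qed
qed

lemma step_props:
  assumes "valid S"
  shows "valid (step S)" "length (step S) \<le> length S" "gconj (prd (vals S)) (prd (vals (step S)))"
proof -
  have "valid (step S) \<and> length (step S) \<le> length S \<and> gconj (prd (vals S)) (prd (vals (step S)))"
    by (rule step_cases[OF assms])
      (use assms gconj_rotate1[OF assms] gconj_refl in \<open>auto simp: valid_def\<close>)
  then show "valid (step S)" "length (step S) \<le> length S" "gconj (prd (vals S)) (prd (vals (step S)))"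
    by auto
qed

lemma funpow_step_props:
  assumes "valid S"
  shows "valid ((step ^^ n) S) \<and> length ((step ^^ n) S) \<le> length S \<and>
    gconj (prd (vals S)) (prd (vals ((step ^^ n) S)))"
proof (induction n)
  case (Suc n)
  then show ?case
    using step_props[of "(step ^^ n) S"] gconj_trans by (auto intro: order_trans)
qed (simp add: assms gconj_refl)

lemma cred_rotate1:
  assumes "cred S" shows "cred (rotate1 S)"
proof (cases S)
  case (Cons x T)
  obtain i g where x: "x = (i, g)" by (cases x)
  have "T \<noteq> []" using assms by (auto simp: Cons cred_def)
  then show ?thesis using assms
    by (auto simp: Cons x cred_def red_append red_Cons red_single)
qed (use assms in \<open>simp add: cred_def\<close>)

lemma cred_rotate: "cred S \<Longrightarrow> cred (rotate n S)"
  by (induction n) (simp_all add: cred_rotate1)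

lemma cred_vals_step:
  assumes "valid S" "cred (vals S)"
  shows "cred (vals (step S))"
  using assms(1)
proof (cases rule: step_cases)
  case (3 x y R)
  then show ?thesis using cred_rotate1[OF assms(2)] by (simp add: vals_def rotate1_map)
qed (use assms(2) in auto)

lemma cred_vals_funpow_step:
  assumes "valid S" "cred (vals S)"
  shows "cred (vals ((step ^^ n) S))"
  by (induction n) (simp_all add: assms cred_vals_step funpow_step_props)

text \<open>A full round of steps without a shortening has only rotated the list, and has tested every
  syllable and every pair of cyclically adjacent syllables on its way.\<close>

lemma funpow_step_rotate:
  assumes "valid S" "length S \<ge> 2" "length ((step ^^ n) S) = length S"
  shows "(step ^^ n) S = rotate n S \<and> (\<forall>k<n. fst (rotate k S ! 0) \<noteq> fst (rotate k S ! 1) \<and>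
    sval (rotate k S ! 0) \<notin> range gexp)"
  using assms(3)
proof (induction n)
  case (Suc n)
  have n: "valid ((step ^^ n) S)" "length ((step ^^ n) S) \<le> length S"
    using funpow_step_props[OF assms(1)] by auto
  then have len: "length ((step ^^ n) S) = length S"
    using step_props(2)[OF n(1)] Suc.prems by simp
  note IH = Suc.IH[OF len]
  from n(1) show ?case
  proof (cases rule: step_cases)
    case (3 x y R)
    then have rot: "rotate n S = x # y # R" using IH by simp
    have "(step ^^ Suc n) S = rotate (Suc n) S"
      using 3(4) IH by simp
    moreover have "fst (rotate n S ! 0) \<noteq> fst (rotate n S ! 1) \<and> sval (rotate n S ! 0) \<notin> range gexp"
      using 3 rot by simp
    ultimately show ?thesis using IH by (auto simp: less_Suc_eq)
  qed (use Suc.prems len assms(2) in auto)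
qed simp

text \<open>A full turn without shortening has tested all cyclic neighbours; the pair that wraps
  around gives the condition on the ends.\<close>

lemma cred_if_round:
  assumes "valid S" "length S \<ge> 2" "length ((step ^^ length S) S) = length S"
  shows "cred (vals S)"
proof -
  let ?n = "length S"
  have good: "fst (S ! k) \<noteq> fst (S ! (Suc k mod ?n)) \<and> sval (S ! k) \<notin> range gexp" if "k < ?n" for k
  proof -
    have "fst (rotate k S ! 0) \<noteq> fst (rotate k S ! 1) \<and> sval (rotate k S ! 0) \<notin> range gexp"
      using funpow_step_rotate[OF assms] that by blast
    moreover have "0 < ?n" using that by linarith
    then have "rotate k S ! 0 = S ! k"
      using nth_rotate[of 0 S k] that by simp
    moreover have "rotate k S ! 1 = S ! (Suc k mod ?n)"
      using nth_rotate[of 1 S k] assms(2) by simp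
    ultimately show ?thesis by simp
  qed
  have "alternating (vals S)"
    unfolding alternating_def successively_conv_nth
  proof (intro allI impI)
    fix i assume "Suc i < length (vals S)"
    then show "fst (vals S ! i) \<noteq> fst (vals S ! Suc i)"
      using good[of i] by (simp add: vals_def)
  qed
  moreover have "\<forall>(i, x) \<in> set (vals S). x \<in> gfactor i \<and> x \<notin> range gexp"
  proof -
    have "x \<notin> range gexp" if ix: "(i, x) \<in> set (vals S)" for i x
    proof -
      obtain k where "k < ?n" "(i, x) = vals S ! k" using ix by (auto simp: in_set_conv_nth)
      then show ?thesis using good[of k] by (simp add: vals_def)
    qed
    then show ?thesis using syllables_vals[OF assms(1)] by (auto simp: syllables_def)
  qed
  moreover have "fst (hd (vals S)) \<noteq> fst (last (vals S))"
  proof -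
    have S: "S \<noteq> []" using assms(2) by auto
    have "Suc (?n - 1) = ?n" using assms(2) by linarith
    then have "Suc (?n - 1) mod ?n = 0" by (simp only: mod_self)
    then have "fst (S ! (?n - 1)) \<noteq> fst (S ! 0)" using good[of "?n - 1"] assms(2) by simp
    then show ?thesis using S
      by (simp add: vals_def hd_map last_map hd_conv_nth last_conv_nth)
  qed
  ultimately show ?thesis using assms(2) by (auto simp: cred_def reduced_def)
qed

text \<open>As long as the list is neither short nor cyclically reduced, every round shortens it.
  Hence length plus number of rounds never exceeds the initial length, and after that many rounds
  nothing could be left.\<close>

lemma reduce_props:
  assumes "valid S"
  shows "valid (reduce S)" "gconj (prd (vals S)) (prd (vals (reduce S)))"
    "length (reduce S) \<le> 1 \<or> cred (vals (reduce S))"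
proof -
  let ?n = "length S"
  define T where "T k = ((step ^^ ?n) ^^ k) S" for k
  have T_Suc: "T (Suc k) = (step ^^ ?n) (T k)" for k by (simp add: T_def)
  have T: "valid (T k) \<and> length (T k) \<le> ?n \<and> gconj (prd (vals S)) (prd (vals (T k)))" for k
  proof (induction k)
    case (Suc k)
    then show ?case
      using funpow_step_props[of "T k" ?n] gconj_trans unfolding T_Suc by (meson order_trans)
  qed (simp add: T_def assms gconj_refl)
  have "length (T k) \<le> 1 \<or> cred (vals (T k)) \<or> length (T k) + k \<le> ?n" for k
  proof (induction k)
    case (Suc k)
    note props = funpow_step_props[of "T k" ?n, folded T_Suc]
    show ?case
    proof (cases "length (T k) \<le> 1 \<or> cred (vals (T k))")
      case True
      then show ?thesis using T[of k] props cred_vals_funpow_step[of "T k" ?n, folded T_Suc] by auto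
    next
      case False
      let ?l = "length (T k)"
      \<comment> \<open>A round has as many steps as the original list had syllables, while one turn
        of the current list takes only \<open>?l\<close> of them; the shortening already happens
        there.\<close>
      have "(step ^^ ?n) (T k) = (step ^^ (?n - ?l)) ((step ^^ ?l) (T k))"
        using T[of k] by (simp flip: funpow_add o_apply[where f = "step ^^ (?n - ?l)"] fun_cong[OF funpow_add])
      moreover have "length ((step ^^ ?l) (T k)) < ?l"
        using cred_if_round[of "T k"] False T[of k] funpow_step_props[of "T k" ?l] by fastforce
      ultimately have "length (T (Suc k)) < ?l"
        unfolding T_Suc using funpow_step_props[of "(step ^^ ?l) (T k)" "?n - ?l"]
          funpow_step_props[of "T k" ?l] T[of k] by auto
      then show ?thesis using Suc False by auto
    qed
  qed (simp add: T_def)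
  from this[of ?n] have "length (T ?n) \<le> 1 \<or> cred (vals (T ?n))" by auto
  moreover have "reduce S = T ?n" by (simp add: reduce_def foldl_ignore T_def)
  ultimately show "valid (reduce S)" "gconj (prd (vals S)) (prd (vals (reduce S)))"
    "length (reduce S) \<le> 1 \<or> cred (vals (reduce S))"
    using T[of ?n] by auto
qed

lemma word_syllables_props:
  assumes "w \<in> words G"
  shows "valid (word_syllables w)" "prd (vals (word_syllables w)) = gperm w"
proof -
  have "valid (word_syllables w) \<and> prd (vals (word_syllables w)) = gperm w"
    using assms
  proof (induction w)
    case (Cons l w)
    obtain n s where l: "l = (n, s)" by (cases l)
    have ln: "[(n div 2, s)] \<in> words (factor (even n))" "[(n, s)] = embed (even n) [(n div 2, s)]"
      and w: "w \<in> words G"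
      using Cons.prems unfolding l by (elim letter_words_G; simp)+
    have "word_syllables (l # w) = (even n, [(n div 2, s)]) # word_syllables w"
      by (simp add: word_syllables_def l)
    moreover have "gperm (l # w) = sval (even n, [(n div 2, s)]) + gperm w"
      using word_perm_append[of G "[l]" w] unfolding sval_def fst_conv snd_conv ln(2)[symmetric] l by simp
    ultimately show ?case using Cons.IH[OF w] ln(1) by simp
  qed (simp add: word_syllables_def)
  then show "valid (word_syllables w)" "prd (vals (word_syllables w)) = gperm w" by auto
qed

subsection \<open>The decision procedure\<close>

definition short :: "(bool \<times> word) list \<Rightarrow> bool" where
  "short S \<longleftrightarrow> length S \<le> 1"

text \<open>The default has value 1, the product of the empty list, so empty and one-syllable lists
  need no separate treatment.\<close>

definition first :: "(bool \<times> word) list \<Rightarrow> bool \<times> word" where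
  "first S = (case S of [] \<Rightarrow> (True, []) | x # _ \<Rightarrow> x)"

text \<open>Being 1 is the same as being conjugate to 1, so the conjugacy oracle with the empty word
  settles the short case.\<close>

definition trivial :: "word \<Rightarrow> bool" where
  "trivial w = (let S = reduce (word_syllables w) in
     short S \<and> cj (fst (first S)) (snd (first S)) [])"

text \<open>The newest rotation is kept at the head so that the next one can be formed from
  it.\<close>

definition rotations :: "(bool \<times> word) list \<Rightarrow> (bool \<times> word) list list" where
  "rotations S = foldl (\<lambda>R _. case R of [] \<Rightarrow> [] | T # _ \<Rightarrow> rotate1 T # R) [S] S"

definition spell :: "(bool \<times> word) list \<Rightarrow> word" where
  "spell S = concat (map (\<lambda>x. embed (fst x) (snd x)) S)"

text \<open>Non-self-conjugacy leaves one intermediate power as an element; its exponents are listed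
  for \<open>x\<close> and tested against \<open>y\<close>.\<close>

definition short_test :: "bool \<times> word \<Rightarrow> bool \<times> word \<Rightarrow> bool" where
  "short_test x y \<longleftrightarrow> fst x = fst y \<and> cj (fst x) (snd x) (snd y) \<or>
     list_ex (\<lambda>k. cj (fst y) (snd y) (power_word (amalgamated (fst y)) k)) (powers (fst x) (snd x))"

text \<open>The word handed to \<open>trivial\<close> spells h^r S h^(-r) R^(-1), where r runs
  through the candidates that the first syllables of \<open>S\<close> and the rotation
  \<open>R\<close> admit.\<close>

definition long_test :: "(bool \<times> word) list \<Rightarrow> (bool \<times> word) list \<Rightarrow> bool" where
  "long_test S T \<longleftrightarrow> list_ex (\<lambda>R. fst (first S) = fst (first R) \<and>
     list_ex (\<lambda>p. trivial (power_word (embed True (amalgamated True)) (fst p) @ spell S @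
         inv_word (power_word (embed True (amalgamated True)) (fst p)) @ inv_word (spell R)))
       (coset (fst (first S)) (snd (first S)) (snd (first R)))) (rotations T)"

definition decide :: "word \<Rightarrow> word \<Rightarrow> bool" where
  "decide u v = (let S = reduce (word_syllables u); T = reduce (word_syllables v) in
     if short S \<and> short T then short_test (first S) (first T)
     else \<not> short S \<and> \<not> short T \<and> long_test S T)"

lemma first_props:
  assumes "valid S"
  shows "snd (first S) \<in> words (factor (fst (first S)))"
    and "short S \<Longrightarrow> prd (vals S) = sval (first S)"
  using assms by (auto simp: first_def short_def sval_def split: list.splits)

lemma spell_props:
  assumes "valid S"
  shows "spell S \<in> words G" "gperm (spell S) = prd (vals S)"
proof -
  have "spell S \<in> words G \<and> gperm (spell S) = prd (vals S)"
    using assms by (induction S) (auto simp: spell_def sval_def embed_words)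
  then show "spell S \<in> words G" "gperm (spell S) = prd (vals S)" by auto
qed

lemma gconj_short:
  assumes "x \<in> gfactor i" "y \<in> gfactor j"
  shows "gconj x y \<longleftrightarrow> short_conj i x j y"
proof
  assume "gconj x y"
  then show "short_conj i x j y"
    unfolding gconj_def using short_conj[OF assms] by blast
next
  assume "short_conj i x j y"
  then show "gconj x y"
    unfolding short_conj_def using gconj_fconj gconj_sym gconj_trans by blast
qed

lemma short_test:
  assumes "snd x \<in> words (factor (fst x))" "snd y \<in> words (factor (fst y))"
  shows "short_test x y \<longleftrightarrow> gconj (sval x) (sval y)"
proof -
  have pw: "power_word (amalgamated i) k \<in> words (factor i)" for i k
    by (rule power_word_words[OF amalgamated_in])
  have pj: "cj (fst y) (snd y) (power_word (amalgamated (fst y)) k) \<longleftrightarrow> fconj (fst y) (sval y) (gexp k)" for k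
    by (simp add: cj[OF assms(2) pw] sval_def gexp_eq[of k "fst y"])
  have "(\<exists>k. fconj (fst x) (sval x) (gexp k) \<and> fconj (fst y) (sval y) (gexp k)) \<longleftrightarrow>
      (\<exists>k \<in> set (powers (fst x) (snd x)). fconj (fst y) (sval y) (gexp k))"
    using powers_sound[OF assms(1)] powers_complete[OF assms(1)] unfolding sval_def by metis
  moreover have "fst x = fst y \<Longrightarrow> cj (fst x) (snd x) (snd y) \<longleftrightarrow> fconj (fst x) (sval x) (sval y)"
    using cj[of "snd x" "fst x" "snd y"] assms by (simp add: sval_def)
  ultimately have "short_test x y \<longleftrightarrow> short_conj (fst x) (sval x) (fst y) (sval y)"
    unfolding short_test_def short_conj_def pj list_ex_iff by blast
  then show ?thesis using gconj_short[OF sval_in[OF assms(1)] sval_in[OF assms(2)]] by simp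
qed

text \<open>Cyclic reduction preserves only the conjugacy class, which is enough for triviality; a
  list that remains long is reduced and nonempty, hence nontrivial.\<close>

lemma trivial_iff:
  assumes "w \<in> words G"
  shows "trivial w \<longleftrightarrow> gperm w = 0"
proof -
  define S where "S = reduce (word_syllables w)"
  have S: "valid S" "gconj (gperm w) (prd (vals S))" "short S \<or> cred (vals S)"
    using reduce_props[OF word_syllables_props(1)[OF assms]] word_syllables_props(2)[OF assms]
    by (auto simp: S_def short_def)
  have zero: "gperm w = 0 \<longleftrightarrow> prd (vals S) = 0"
    using S(2) gconj_zero_iff gconj_sym by metis
  show ?thesis
  proof (cases "short S")
    case True
    have "cj (fst (first S)) (snd (first S)) [] \<longleftrightarrow> fconj (fst (first S)) (sval (first S)) 0"
      using cj[OF first_props(1)[OF S(1)], of "[]"] by (simp add: sval_def)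
    also have "\<dots> \<longleftrightarrow> sval (first S) = 0"
      using gconj_fconj gconj_zero_iff fconj_refl by metis
    finally show ?thesis
      using zero first_props(2)[OF S(1) True] True by (simp add: trivial_def Let_def flip: S_def)
  next
    case False
    then have "prd (vals S) \<noteq> 0"
      using S(3) red_not_e[of "vals S" 0] by (auto simp: cred_def)
    then show ?thesis using zero False by (simp add: trivial_def Let_def flip: S_def)
  qed
qed

lemma set_rotations: "set (rotations S) = {rotate n S |n. n \<le> length S}"
proof -
  have "foldl (\<lambda>R _. case R of [] \<Rightarrow> [] | T # _ \<Rightarrow> rotate1 T # R) [S] xs =
      rev (map (\<lambda>n. rotate n S) [0..<Suc (length xs)])" for xs :: "(bool \<times> word) list"
    by (induction xs rule: rev_induct) simp_all
  then show ?thesis by (auto simp: rotations_def less_Suc_eq_le simp del: upt_Suc)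
qed

lemma rotate_in_rotations: "rotate n S \<in> set (rotations S)"
proof (cases "S = []")
  case False
  then have "rotate n S = rotate (n mod length S) S" "n mod length S \<le> length S"
    by (simp_all add: rotate_conv_mod[symmetric] less_imp_le)
  then show ?thesis unfolding set_rotations by blast
qed (auto simp: set_rotations)

text \<open>Accepted candidates are conjugating powers by \<open>key\<close>. Conversely,
  \<open>cred_conj\<close> supplies a rotation and a power, and \<open>first_syllable\<close> makes
  that power a double coset solution, hence listed.\<close>

lemma long_test:
  assumes "valid S" "valid T" "cred (vals S)" "cred (vals T)"
  shows "long_test S T \<longleftrightarrow> gconj (prd (vals S)) (prd (vals T))"
proof -
  have S_ne: "S \<noteq> []" using assms(3) by (auto simp: cred_def)
  have key: "trivial (power_word (embed True (amalgamated True)) r @ spell S @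
         inv_word (power_word (embed True (amalgamated True)) r) @ inv_word (spell R)) \<longleftrightarrow>
      gexp r + prd (vals S) + - gexp r = prd (vals R)" if R: "valid R" for r R
  proof -
    let ?p = "power_word (embed True (amalgamated True)) r"
    have p: "?p \<in> words G" by (rule power_word_words[OF embed_words[OF amalgamated_in]])
    have "gperm (?p @ spell S @ inv_word ?p @ inv_word (spell R)) =
        (gexp r + prd (vals S) + - gexp r) + - prd (vals R)"
      by (simp only: word_perm_append word_perm_inv_word[OF wf_G] spell_props[OF assms(1)]
          spell_props[OF R] gexp_def[symmetric] add.assoc)
    moreover have "?p @ spell S @ inv_word ?p @ inv_word (spell R) \<in> words G"
      using p spell_props[OF assms(1)] spell_props[OF R] by (simp add: inv_word_words)
    ultimately show ?thesis using trivial_iff by simp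
  qed
  show ?thesis
  proof
    assume "long_test S T"
    then obtain R r where R: "R \<in> set (rotations T)" and r: "trivial (power_word (embed True (amalgamated True)) r @
        spell S @ inv_word (power_word (embed True (amalgamated True)) r) @ inv_word (spell R))"
      unfolding long_test_def list_ex_iff by blast
    obtain n where n: "R = rotate n T" using R by (auto simp: set_rotations)
    have R: "valid R" "gconj (prd (vals T)) (prd (vals R))"
      using gconj_rotate[OF assms(2)] by (auto simp: n)
    have "prd (vals R) = - (- gexp r) + prd (vals S) + - gexp r"
      using key[OF R(1), of r] r by simp
    moreover have "- gexp r \<in> gfactor True" using e_in F_uminus by blast
    ultimately have "gconj (prd (vals S)) (prd (vals R))"
      using gconj_fconj unfolding fconj_def by blast
    then show "gconj (prd (vals S)) (prd (vals T))"
      using R(2) gconj_sym gconj_trans by blast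
  next
    assume "gconj (prd (vals S)) (prd (vals T))"
    then obtain L where "syllables L" "prd (vals T) = - prd L + prd (vals S) + prd L"
      by (auto simp: gconj_def)
    from cred_conj[OF assms(3,4) this] obtain n k
      where nk: "prd (rotate n (vals T)) = gexp k + prd (vals S) + - gexp k" by blast
    define R where "R = rotate n T"
    have vR: "vals R = rotate n (vals T)" by (simp add: R_def vals_def rotate_map)
    have R: "valid R" "R \<in> set (rotations T)" "cred (vals R)"
      using gconj_rotate[OF assms(2)] rotate_in_rotations cred_rotate[OF assms(4)]
      by (auto simp: R_def vR[unfolded R_def])
    \<comment> \<open>A single syllable has equal ends, so \<open>cred\<close> forces length at
      least two.\<close>
    have len: "length (vals S) \<ge> 2"
      using assms(3) by (cases "vals S"; cases "tl (vals S)") (auto simp: cred_def)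
    have red: "red (vals S)" "red (vals R)" using assms(3) R(3) by (auto simp: cred_def)
    have eq: "prd (vals R) = gexp k + prd (vals S) + - gexp k" using nk by (simp add: vR)
    from first_syllable[OF red(1) len red(2) eq] obtain s where
      s: "R \<noteq> []" "fst (hd (vals S)) = fst (hd (vals R))"
      "gexp k + snd (hd (vals S)) + gexp s = snd (hd (vals R))" by auto
    have fS: "fst (first S) = fst (hd (vals S))" "sval (first S) = snd (hd (vals S))"
      using S_ne by (cases S; simp add: first_def)+
    have fR: "fst (first R) = fst (hd (vals R))" "sval (first R) = snd (hd (vals R))"
      using s(1) by (cases R; simp add: first_def)+
    have mem: "snd (first S) \<in> words (factor (fst (first S)))" "snd (first R) \<in> words (factor (fst (first S)))"
      using first_props(1)[OF assms(1)] first_props(1)[OF R(1)] s(2) fS fR by auto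
    have "sval (first S) \<notin> range gexp"
      using red(1) S_ne by (cases S) (auto simp: first_def reduced_def)
    moreover have "gexp k + sval (first S) + gexp s = sval (first R)" using s fS fR by simp
    ultimately obtain p where p: "p \<in> set (coset (fst (first S)) (snd (first S)) (snd (first R)))"
      "gexp (fst p) = gexp k"
      using coset_complete[OF mem, of k s] s(2) fS(1) fR(1) by (auto simp: sval_def)
    \<comment> \<open>The listed exponent may differ from \<open>k\<close> as an integer, but it
      names the same power.\<close>
    have "gexp (fst p) + prd (vals S) + - gexp (fst p) = prd (vals R)"
      using eq p(2) by simp
    then show "long_test S T"
      unfolding long_test_def list_ex_iff using key[OF R(1)] R(2) p(1) s(2) fS(1) fR(1) by metis
  qed
qed

theorem decide:
  assumes "u \<in> words G" "v \<in> words G"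
  shows "decide u v \<longleftrightarrow> conjugate (pgroup G) (elt G u) (elt G v)"
proof -
  define S where "S = reduce (word_syllables u)"
  define T where "T = reduce (word_syllables v)"
  have S: "valid S" "gconj (gperm u) (prd (vals S))" "short S \<or> cred (vals S)"
    using reduce_props[OF word_syllables_props(1)[OF assms(1)]] word_syllables_props(2)[OF assms(1)]
    by (auto simp: S_def short_def)
  have T: "valid T" "gconj (gperm v) (prd (vals T))" "short T \<or> cred (vals T)"
    using reduce_props[OF word_syllables_props(1)[OF assms(2)]] word_syllables_props(2)[OF assms(2)]
    by (auto simp: T_def short_def)
  note fS = first_props[OF S(1)] and fT = first_props[OF T(1)]
  have dec: "decide u v = (if short S \<and> short T then short_test (first S) (first T)
     else \<not> short S \<and> \<not> short T \<and> long_test S T)"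
    by (simp add: decide_def Let_def S_def T_def)
  have "decide u v \<longleftrightarrow> gconj (prd (vals S)) (prd (vals T))"
  proof -
    \<comment> \<open>In the mixed cases \<open>cred_not_short_conj\<close> confirms the answer
      no.\<close>
    consider "short S" "short T" | "short S" "\<not> short T" | "\<not> short S" "short T" | "\<not> short S" "\<not> short T"
      by blast
    then show ?thesis
    proof cases
      case 1
      then show ?thesis using short_test[OF fS(1) fT(1)] fS(2) fT(2) by (simp add: dec)
    next
      case 2
      have "\<not> gconj (prd (vals S)) (prd (vals T))"
        using cred_not_short_conj[of "vals T", OF _ sval_in[OF fS(1)]] T(3) 2 fS(2)
        unfolding gconj_def by auto
      then show ?thesis using 2 by (simp add: dec)
    next
      case 3
      have "\<not> gconj (prd (vals T)) (prd (vals S))"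
        using cred_not_short_conj[of "vals S", OF _ sval_in[OF fT(1)]] S(3) 3 fT(2)
        unfolding gconj_def by auto
      then show ?thesis using 3 gconj_sym by (auto simp: dec)
    next
      case 4
      then show ?thesis using long_test[OF S(1) T(1)] S(3) T(3) by (simp add: dec)
    qed
  qed
  also have "\<dots> \<longleftrightarrow> gconj (gperm u) (gperm v)"
    using S(2) T(2) gconj_sym gconj_trans by metis
  \<comment> \<open>Products of syllables and words of \<open>G\<close> name the same
    conjugators.\<close>
  also have "\<dots> \<longleftrightarrow> (\<exists>g\<in>words G. gperm v = - gperm g + gperm u + gperm g)"
  proof
    assume "gconj (gperm u) (gperm v)"
    then obtain L where L: "syllables L" "gperm v = - prd L + gperm u + prd L"
      by (auto simp: gconj_def)
    have "\<exists>g\<in>words G. prd L = gperm g"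
      using L(1)
    proof (induction L)
      case Nil
      show ?case by (rule bexI[of _ "[]"]) simp_all
    next
      case (Cons p L)
      then obtain g where g: "g \<in> words G" "prd L = gperm g" by (auto simp: syllables_def)
      obtain i x where p: "p = (i, x)" by (cases p)
      then have "x \<in> gfactor i" using Cons.prems by (simp add: syllables_def)
      then obtain w where "w \<in> words (factor i)" "x = gperm (embed i w)"
        unfolding gfactor_def by blast
      then show ?case using g embed_words[of w i] p
        by (intro bexI[of _ "embed i w @ g"]) simp_all
    qed
    then show "\<exists>g\<in>words G. gperm v = - gperm g + gperm u + gperm g" using L(2) by auto
  next
    assume "\<exists>g\<in>words G. gperm v = - gperm g + gperm u + gperm g"
    then show "gconj (gperm u) (gperm v)"
      unfolding gconj_def using words_G_syllables by metis
  qed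
  also have "\<dots> \<longleftrightarrow> conjugate (pgroup G) (elt G u) (elt G v)"
    by (rule conjugate_word_perm_iff[OF wf_G assms, symmetric])
  finally show ?thesis .
qed

end

section \<open>Computability of the decision procedure\<close>

lemma computable_concat_replicate:
  assumes "computable n"
  shows "computable (\<lambda>x. concat (replicate (n x) (u :: 'b::encodable list)))"
proof -
  have eq: "rec_nat [] (\<lambda>k r. u @ r) m = concat (replicate m u)" for m
    by (induction m) auto
  have "computable (\<lambda>x. rec_nat [] (\<lambda>k r. u @ r) (n x))"
    by (intro computable_intros assms)
  then show ?thesis by (simp only: eq)
qed

lemma computable_power_word:
  assumes "computable k"
  shows "computable (\<lambda>x. power_word h (k x))"
proof -
  \<comment> \<open>Even codes \<open>n\<close> stand for n div 2 and odd ones for -(n div 2) - 1,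
    whence the \<open>Suc\<close> in the odd branch.\<close>
  have eq: "power_word h (int_decode n) = (if even n then concat (replicate (n div 2) h)
      else concat (replicate (Suc (n div 2)) (inv_word h)))" for n
    by (simp add: power_word_def int_decode_def sum_decode_def nat_add_distrib)
  have "computable (\<lambda>n. power_word h (int_decode n))"
    unfolding eq
    by (intro computable_intros computable_concat_replicate computable_parity_half)
  \<comment> \<open>An integer and its code have the same code, so the identity tracks
    \<open>int_encode\<close>.\<close>
  moreover have "computable int_encode"
    by (rule computableI[OF recursive_fun_id]) (simp add: enc_int_def enc_nat_def)
  ultimately have "computable (\<lambda>k. power_word h (int_decode (int_encode k)))"
    by (rule computable_comp)
  then have "computable (power_word h)" by simp
  from computable_comp[OF this assms] show ?thesis .
qed

lemma computable_inv_word: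
  assumes "computable w"
  shows "computable (\<lambda>x. inv_word (w x))"
proof -
  have eq: "inv_word v = rev (map (\<lambda>l. (fst l, \<not> snd l)) v)" for v
    by (simp add: inv_word_def split_def)
  show ?thesis unfolding eq by (intro computable_intros assms)
qed

lemma computable_rotate1:
  assumes "computable l"
  shows "computable (\<lambda>x. rotate1 (l x))"
proof -
  have eq: "rotate1 S = (case S of [] \<Rightarrow> [] | x # T \<Rightarrow> T @ [x])" for S :: "'c list"
    by (cases S) simp_all
  show ?thesis unfolding eq by (intro computable_intros assms)
qed

text \<open>Turns an uncurried oracle into an introduction rule for calls with computed
  arguments.\<close>

lemma computable3:
  assumes "computable (\<lambda>p. f (fst p) (fst (snd p)) (snd (snd p)))"
    and "computable i" "computable u" "computable v"
  shows "computable (\<lambda>x. f (i x) (u x) (v x))"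
  using computable_comp[OF assms(1) computable_Pair[OF assms(2) computable_Pair[OF assms(3,4)]]]
  by simp

lemma computable2:
  assumes "computable (\<lambda>p. f (fst p) (snd p))" and "computable i" "computable u"
  shows "computable (\<lambda>x. f (i x) (u x))"
  using computable_comp[OF assms(1) computable_Pair[OF assms(2,3)]] by simp

locale computable_amalgam_search = amalgam_search +
  assumes computable_cj: "computable (\<lambda>p. cj (fst p) (fst (snd p)) (snd (snd p)))"
    and computable_powers: "computable (\<lambda>p. powers (fst p) (snd p))"
    and computable_coset: "computable (\<lambda>p. coset (fst p) (fst (snd p)) (snd (snd p)))"
begin

lemmas oracle_intros = computable3[OF computable_cj] computable2[OF computable_powers]
  computable3[OF computable_coset] computable_power_word computable_inv_word computable_rotate1
  computable_parity_half

lemma computable_amalgamated_power: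
  assumes "computable i" "computable k"
  shows "computable (\<lambda>x. power_word (amalgamated (i x)) (k x))"
proof -
  have eq: "power_word (amalgamated j) m = (if j then power_word a m else power_word b m)" for j m
    by (simp add: amalgamated_def)
  show ?thesis unfolding eq by (intro computable_intros oracle_intros assms)
qed

lemma computable_embed:
  assumes "computable i" "computable w"
  shows "computable (\<lambda>x. embed (i x) (w x))"
proof -
  have eq: "embed j v = (if j then map (\<lambda>l. (2 * fst l, snd l)) v
      else map (\<lambda>l. (Suc (2 * fst l), snd l)) v)" for j v
    by (simp add: embed_def split_def)
  show ?thesis unfolding eq by (intro computable_intros assms)
qed

lemma computable_transfer_word:
  assumes "computable i" "computable w"
  shows "computable (\<lambda>x. transfer_word (i x) (w x))"
proof -
  have "computable (\<lambda>p. transfer_word (fst p) (snd p))"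
    unfolding transfer_word_def
    by (intro computable_intros oracle_intros computable_amalgamated_power)
  from computable2[OF this assms] show ?thesis .
qed

lemma computable_step: "computable step"
proof -
  have "computable (\<lambda>S. step S)"
    unfolding step_def by (intro computable_intros computable_transfer_word)
  then show ?thesis by simp
qed

lemma computable_reduce:
  assumes "computable S"
  shows "computable (\<lambda>x. reduce (S x))"
proof -
  have "computable (\<lambda>S. reduce S)"
    unfolding reduce_def by (intro computable_intros computable_comp[OF computable_step])
  from computable_comp[OF this assms] show ?thesis .
qed

lemma computable_word_syllables:
  assumes "computable w"
  shows "computable (\<lambda>x. word_syllables (w x))"
  unfolding word_syllables_def by (intro computable_intros computable_parity_half assms)

lemma computable_short:
  assumes "computable S"
  shows "computable (\<lambda>x. short (S x))"
proof -
  have eq: "short S = (case S of [] \<Rightarrow> True | x # T \<Rightarrow> (case T of [] \<Rightarrow> True | y # R \<Rightarrow> False))" for S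
    by (simp add: short_def split: list.splits)
  show ?thesis unfolding eq by (intro computable_intros assms)
qed

lemma computable_first:
  assumes "computable S"
  shows "computable (\<lambda>x. first (S x))"
  unfolding first_def by (intro computable_intros assms)

lemma computable_trivial:
  assumes "computable w"
  shows "computable (\<lambda>x. trivial (w x))"
proof -
  have "computable (\<lambda>w. trivial w)"
    unfolding trivial_def Let_def
    by (intro computable_intros oracle_intros computable_reduce computable_word_syllables
        computable_short computable_first)
  from computable_comp[OF this assms] show ?thesis .
qed

lemma computable_rotations:
  assumes "computable S"
  shows "computable (\<lambda>x. rotations (S x))"
  unfolding rotations_def by (intro computable_intros computable_rotate1 assms)

lemma computable_spell:
  assumes "computable S"
  shows "computable (\<lambda>x. spell (S x))"
  unfolding spell_def by (intro computable_intros computable_embed assms)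

lemma computable_short_test: "computable (\<lambda>p. short_test (fst p) (snd p))"
  unfolding short_test_def
  by (intro computable_intros oracle_intros computable_amalgamated_power)

lemma computable_long_test: "computable (\<lambda>p. long_test (fst p) (snd p))"
  unfolding long_test_def
  by (intro computable_intros oracle_intros computable_first computable_trivial computable_spell
      computable_rotations)

lemma computable_decide: "computable (\<lambda>p. decide (fst p) (snd p))"
  unfolding decide_def Let_def
  by (intro computable_intros computable2[OF computable_short_test] computable2[OF computable_long_test]
      computable_reduce computable_word_syllables computable_short computable_first)

lemma solvable_conjugacy_problem_amalgam: "solvable_conjugacy_problem G"
proof -
  obtain f where f: "recursive_fun f" "\<And>p. f (enc p) = enc (decide (fst p) (snd p))"
    using computableE[OF computable_decide] by blast
  have "f (prod_encode (word_code u, word_code v)) =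
      (if conjugate (pgroup G) (elt G u) (elt G v) then 1 else 0)"
    if "u \<in> words G" "v \<in> words G" for u v
    using f(2)[of "(u, v)"] decide[OF that] by (simp add: enc_prod_def enc_word enc_bool_def)
  then show ?thesis unfolding solvable_conjugacy_problem_def using f(1) by blast
qed

end

section \<open>Oracles extracted from the hypotheses on a factor\<close>

lemma solvable_conjugacy_problem_computable:
  assumes "solvable_conjugacy_problem P"
  obtains c where "computable (\<lambda>p. c (fst p) (snd p))"
    "\<And>u v. u \<in> words P \<Longrightarrow> v \<in> words P \<Longrightarrow> c u v \<longleftrightarrow> conjugate (pgroup P) (elt P u) (elt P v)"
proof -
  obtain f where f: "recursive_fun f" "\<forall>u\<in>words P. \<forall>v\<in>words P.
        f (prod_encode (word_code u, word_code v)) =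
          (if conjugate (pgroup P) (elt P u) (elt P v) then 1 else 0)"
    using assms unfolding solvable_conjugacy_problem_def by blast
  define c where "c u v \<longleftrightarrow> f (enc (u :: word, v :: word)) \<noteq> 0" for u v
  have "computable (\<lambda>p :: word \<times> word. f (enc p))"
    by (rule computableI[OF f(1)]) (simp add: enc_nat_def)
  then have "computable (\<lambda>p. c (fst p) (snd p))"
    unfolding c_def prod.collapse by (rule computable_nat_nonzero)
  moreover have "c u v \<longleftrightarrow> conjugate (pgroup P) (elt P u) (elt P v)"
    if "u \<in> words P" "v \<in> words P" for u v
    using f(2) that by (simp add: c_def enc_prod_def enc_word)
  ultimately show ?thesis using that by blast
qed

lemma conjugate_power_search_computable:
  assumes "conjugate_power_search_solvable P h"
  obtains c :: "word \<Rightarrow> int list" where "computable c"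
    "\<And>w k. w \<in> words P \<Longrightarrow> k \<in> set (c w) \<Longrightarrow> conjugate (pgroup P) (elt P w) (h [^]\<^bsub>pgroup P\<^esub> k)"
    "\<And>w k. w \<in> words P \<Longrightarrow> conjugate (pgroup P) (elt P w) (h [^]\<^bsub>pgroup P\<^esub> (k::int)) \<Longrightarrow>
      \<exists>k'\<in>set (c w). h [^]\<^bsub>pgroup P\<^esub> k' = h [^]\<^bsub>pgroup P\<^esub> k"
proof -
  obtain f where f: "recursive_fun f" "\<forall>w\<in>words P.
        let L = set (int_list_decode (f (word_code w))) in
        (\<forall>k\<in>L. conjugate (pgroup P) (elt P w) (h [^]\<^bsub>pgroup P\<^esub> k)) \<and>
        (\<forall>k::int. conjugate (pgroup P) (elt P w) (h [^]\<^bsub>pgroup P\<^esub> k) \<longrightarrow>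
          (\<exists>k'\<in>L. h [^]\<^bsub>pgroup P\<^esub> k' = h [^]\<^bsub>pgroup P\<^esub> k))"
    using assms unfolding conjugate_power_search_solvable_def by blast
  define c where "c w = int_list_decode (f (word_code w))" for w
  have "computable c"
    by (rule computableI[OF f(1)]) (simp add: c_def enc_word enc_int_list_decode)
  then show ?thesis using f(2) that[of c] unfolding c_def[symmetric] Let_def by blast
qed

lemma double_coset_search_computable:
  assumes "double_coset_search_solvable P h"
  obtains c where "computable (\<lambda>p. c (fst p) (snd p))"
    "\<And>u v p. u \<in> words P \<Longrightarrow> v \<in> words P \<Longrightarrow> p \<in> set (c u v) \<Longrightarrow>
      double_coset_solution (pgroup P) h (elt P u) (elt P v) p"
    "\<And>u v p. u \<in> words P \<Longrightarrow> v \<in> words P \<Longrightarrow>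
      double_coset_solution (pgroup P) h (elt P u) (elt P v) p \<Longrightarrow> c u v \<noteq> []"
    "\<And>u v r s. u \<in> words P \<Longrightarrow> v \<in> words P \<Longrightarrow> elt P u \<notin> generate (pgroup P) {h} \<Longrightarrow>
      double_coset_solution (pgroup P) h (elt P u) (elt P v) (r, s) \<Longrightarrow>
      \<exists>p\<in>set (c u v). h [^]\<^bsub>pgroup P\<^esub> fst p = h [^]\<^bsub>pgroup P\<^esub> r"
proof -
  obtain f where f: "recursive_fun f" "\<forall>u\<in>words P. \<forall>v\<in>words P.
        let L = set (int_pair_list_decode (f (prod_encode (word_code u, word_code v))));
            sol = double_coset_solution (pgroup P) h (elt P u) (elt P v) in
        (\<forall>p\<in>L. sol p) \<and>
        ((\<exists>p. sol p) \<longrightarrow> L \<noteq> {}) \<and>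
        (elt P u \<notin> generate (pgroup P) {h} \<longrightarrow>
          (\<forall>r s. sol (r, s) \<longrightarrow>
            (\<exists>(r', s')\<in>L. h [^]\<^bsub>pgroup P\<^esub> r' = h [^]\<^bsub>pgroup P\<^esub> r \<and>
              h [^]\<^bsub>pgroup P\<^esub> s' = h [^]\<^bsub>pgroup P\<^esub> s)))"
    using assms unfolding double_coset_search_solvable_def by blast
  define c where "c u v = int_pair_list_decode (f (prod_encode (word_code u, word_code v)))" for u v
  have comp: "computable (\<lambda>p. c (fst p) (snd p))"
    by (rule computableI[OF f(1)]) (simp add: c_def enc_word enc_int_pair_list_decode enc_prod_def)
  note f2 = f(2)[unfolded Let_def c_def[symmetric], rule_format]
  show ?thesis
  proof (rule that[OF comp])
    fix u v p assume uv: "u \<in> words P" "v \<in> words P"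
    note f2 = f2[OF uv]
    show "p \<in> set (c u v) \<Longrightarrow> double_coset_solution (pgroup P) h (elt P u) (elt P v) p"
      using f2 by blast
    show "double_coset_solution (pgroup P) h (elt P u) (elt P v) p \<Longrightarrow> c u v \<noteq> []"
      using f2 by (metis set_empty)
  next
    fix u v r s assume uv: "u \<in> words P" "v \<in> words P"
      and H: "elt P u \<notin> generate (pgroup P) {h}"
      and sol: "double_coset_solution (pgroup P) h (elt P u) (elt P v) (r, s)"
    have "\<exists>(r', s')\<in>set (c u v). h [^]\<^bsub>pgroup P\<^esub> r' = h [^]\<^bsub>pgroup P\<^esub> r \<and>
              h [^]\<^bsub>pgroup P\<^esub> s' = h [^]\<^bsub>pgroup P\<^esub> s"
      using f2[OF uv] H sol by blast
    then show "\<exists>p\<in>set (c u v). h [^]\<^bsub>pgroup P\<^esub> fst p = h [^]\<^bsub>pgroup P\<^esub> r"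
      by force
  qed
qed

section \<open>Specifications of the oracles restated inside the amalgamated product\<close>

context presented_amalgam
begin

lemma double_coset_solution_iff:
  assumes "u \<in> words (factor i)" "v \<in> words (factor i)"
  shows "double_coset_solution (pgroup (factor i)) (elt (factor i) (amalgamated i))
      (elt (factor i) u) (elt (factor i) v) (r, s) \<longleftrightarrow>
    gexp r + gperm (embed i u) + gexp s = gperm (embed i v)"
proof -
  let ?p = "\<lambda>k. power_word (amalgamated i) k"
  have p: "?p k \<in> words (factor i)" for k
    by (rule power_word_words[OF amalgamated_in])
  have "double_coset_solution (pgroup (factor i)) (elt (factor i) (amalgamated i))
      (elt (factor i) u) (elt (factor i) v) (r, s) \<longleftrightarrow>
      elt (factor i) (?p r @ u @ ?p s) = elt (factor i) v"
    using p assms by (simp add: double_coset_solution_def mult_elt wf_factor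
        flip: elt_power_word[OF wf_factor amalgamated_in])
  also have "\<dots> \<longleftrightarrow> fperm i (?p r @ u @ ?p s) = fperm i v"
    using p assms by (simp add: fperm_def word_perm_eq_iff[OF wf_factor] del: word_perm_append)
  also have "\<dots> \<longleftrightarrow> gperm (embed i (?p r @ u @ ?p s)) = gperm (embed i v)"
    using p assms by (intro gperm_embed_eq_iff[symmetric]) simp_all
  finally show ?thesis by (simp add: gexp_eq[of _ i] add.assoc)
qed

lemma elt_mem_generate_iff:
  assumes "u \<in> words (factor i)"
  shows "elt (factor i) u \<in> generate (pgroup (factor i)) {elt (factor i) (amalgamated i)} \<longleftrightarrow>
    gperm (embed i u) \<in> range gexp"
proof -
  have p: "power_word (amalgamated i) k \<in> words (factor i)" for k
    by (rule power_word_words[OF amalgamated_in])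
  have "elt (factor i) u = elt (factor i) (amalgamated i) [^]\<^bsub>pgroup (factor i)\<^esub> k \<longleftrightarrow>
      gperm (embed i u) = gexp k" for k :: int
    using p assms
    by (simp add: gexp_eq[of _ i] gperm_embed_eq_iff fperm_def word_perm_eq_iff[OF wf_factor]
        elt_power_word[OF wf_factor amalgamated_in])
  then show ?thesis
    using group.generate_pow[OF group_pgroup[OF wf_factor] elt_closed[OF amalgamated_in]]
    by auto
qed

lemma conjugate_power_iff:
  assumes "u \<in> words (factor i)"
  shows "conjugate (pgroup (factor i)) (elt (factor i) u)
      (elt (factor i) (amalgamated i) [^]\<^bsub>pgroup (factor i)\<^esub> (k::int)) \<longleftrightarrow>
    fconj i (gperm (embed i u)) (gexp k)"
  using fconj_iff[OF assms power_word_words[OF amalgamated_in], of k]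
  by (simp add: gexp_eq[of _ i] elt_power_word[OF wf_factor amalgamated_in])

end

theorem mainTheorem4:
  fixes A B :: presentation and a b :: word
  assumes "wf_presentation A" and "wf_presentation B"
    and "solvable_conjugacy_problem A" and "solvable_conjugacy_problem B"
    and "a \<in> words A" and "b \<in> words B"
    and "super_semicritical A (elt A a)" and "super_semicritical B (elt B b)"
    and "\<exists>\<phi> \<in> iso (cyclic_subgroup A (elt A a)) (cyclic_subgroup B (elt B b)).
           \<phi> (elt A a) = elt B b"
  shows "solvable_conjugacy_problem (amalgam A B a b)"
proof -
  interpret presented_amalgam A B a b
    using assms by unfold_locales (simp_all add: super_semicritical_def)
  have semi: "conjugate_power_search_solvable (factor i) (elt (factor i) (amalgamated i))"
    "double_coset_search_solvable (factor i) (elt (factor i) (amalgamated i))"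
    "solvable_conjugacy_problem (factor i)" for i
    using assms by (simp_all add: super_semicritical_def factor_def amalgamated_def)
  let ?h = "\<lambda>i. elt (factor i) (amalgamated i)"
  have "\<exists>c. computable (\<lambda>p. c (fst p) (snd p)) \<and>
      (\<forall>u\<in>words (factor i). \<forall>v\<in>words (factor i).
        c u v \<longleftrightarrow> fconj i (gperm (embed i u)) (gperm (embed i v)))" for i
    by (rule solvable_conjugacy_problem_computable[OF semi(3)[of i]], rule exI)
      (auto simp: fconj_iff)
  \<comment> \<open>The oracles of the two factors are gathered into one function of the
    side.\<close>
  from choice[OF allI[OF this]] obtain cj where cj: "\<forall>i. computable (\<lambda>p. cj i (fst p) (snd p)) \<and>
      (\<forall>u\<in>words (factor i). \<forall>v\<in>words (factor i).
        cj i u v \<longleftrightarrow> fconj i (gperm (embed i u)) (gperm (embed i v)))"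
    by (rule exE)
  have "\<exists>c. computable c \<and> (\<forall>u\<in>words (factor i).
      (\<forall>k\<in>set (c u). fconj i (gperm (embed i u)) (gexp k)) \<and>
      (\<forall>k. fconj i (gperm (embed i u)) (gexp k) \<longrightarrow> (\<exists>k'\<in>set (c u). gexp k' = gexp k)))" for i
    by (rule conjugate_power_search_computable[OF semi(1)[of i]], rule exI)
      (auto simp: conjugate_power_iff gexp_eq_iff[of _ _ i] fexp_eq_iff)
  from choice[OF allI[OF this]] obtain powers where powers: "\<forall>i. computable (powers i) \<and>
      (\<forall>u\<in>words (factor i).
        (\<forall>k\<in>set (powers i u). fconj i (gperm (embed i u)) (gexp k)) \<and>
        (\<forall>k. fconj i (gperm (embed i u)) (gexp k) \<longrightarrow> (\<exists>k'\<in>set (powers i u). gexp k' = gexp k)))"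
    by (rule exE)
  have "\<exists>c. computable (\<lambda>p. c (fst p) (snd p)) \<and> (\<forall>u\<in>words (factor i). \<forall>v\<in>words (factor i).
      (\<forall>(r, s)\<in>set (c u v). gexp r + gperm (embed i u) + gexp s = gperm (embed i v)) \<and>
      (\<forall>r s. gexp r + gperm (embed i u) + gexp s = gperm (embed i v) \<longrightarrow> c u v \<noteq> [] \<and>
        (gperm (embed i u) \<notin> range gexp \<longrightarrow> (\<exists>p\<in>set (c u v). gexp (fst p) = gexp r))))" for i
    by (rule double_coset_search_computable[OF semi(2)[of i]], rule exI)
      (auto simp: gexp_eq_iff[of _ _ i] fexp_eq_iff
        simp flip: double_coset_solution_iff elt_mem_generate_iff)
  from choice[OF allI[OF this]] obtain coset where coset: "\<forall>i.
      computable (\<lambda>p. coset i (fst p) (snd p)) \<and> (\<forall>u\<in>words (factor i). \<forall>v\<in>words (factor i).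
      (\<forall>(r, s)\<in>set (coset i u v). gexp r + gperm (embed i u) + gexp s = gperm (embed i v)) \<and>
      (\<forall>r s. gexp r + gperm (embed i u) + gexp s = gperm (embed i v) \<longrightarrow> coset i u v \<noteq> [] \<and>
        (gperm (embed i u) \<notin> range gexp \<longrightarrow> (\<exists>p\<in>set (coset i u v). gexp (fst p) = gexp r))))"
    by (rule exE)
  \<comment> \<open>With only two sides, a case distinction combines the two algorithms into one
    that is computable in the side as well.\<close>
  have by_side: "computable (\<lambda>p. f (fst p) (snd p))"
    if "\<And>i. computable (f i)" for f :: "bool \<Rightarrow> 'x::encodable \<Rightarrow> 'y::encodable"
  proof -
    have "(\<lambda>p. f (fst p) (snd p)) = (\<lambda>p. if fst p then f True (snd p) else f False (snd p))"
      by (auto simp: fun_eq_iff)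
    then show ?thesis
      by (simp only:) (intro computable_intros computable_comp[OF that])
  qed
  interpret computable_amalgam_search A B a b cj powers coset
  proof unfold_locales
    show "computable (\<lambda>p. cj (fst p) (fst (snd p)) (snd (snd p)))"
      by (rule by_side[of "\<lambda>i q. cj i (fst q) (snd q)"]) (simp add: cj)
    show "computable (\<lambda>p. powers (fst p) (snd p))"
      by (rule by_side) (simp add: powers)
    show "computable (\<lambda>p. coset (fst p) (fst (snd p)) (snd (snd p)))"
      by (rule by_side[of "\<lambda>i q. coset i (fst q) (snd q)"]) (simp add: coset)
  qed (use cj powers coset in blast)+
  show ?thesis by (rule solvable_conjugacy_problem_amalgam)
qed

end
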